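(* There exists an algorithm that solves the assignment problem for the connected $k$-center problem with disjoint clusters optimally when the connectivity graph is a tree, in time $O(nk\log n)$, where $n=|V|$ and $k$ is the number of given centers.
   Context: In the assignment problem for connected $k$-center with disjoint clusters, one is given a finite point set $V$ with $n=|V|$, a metric $d$ on $V$, an unweighted undirected connectivity graph $G=(V,E)$ (here a tree), and a set of $k$ given centers $c_1,\dots,c_k\in V$. A feasible solution is a partition of $V$ into clusters $C_1,\dots,C_k$ with $c_i\in C_i$ such that each $C_i$ induces a connected subgraph of $G$; its radius is $\max_i\max_{x\in C_i}d(x,c_i)$, to be minimized. *)

theory Defs
  imports "HOL-Analysis.Analysis"
begin

section \<open>Finite simple undirected graphs\<close>

text \<open>A graph on the vertex set \<open>V\<close> is given by its set \<open>E\<close> of edges, each edge being a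
  two-element set of vertices. (The predicates \<open>tree\<close> and \<open>forest\<close> of the digraph library
  only exclude \<^emph>\<open>directed\<close> cycles, so they do not describe undirected trees.)\<close>

definition simple_graph :: "'a set \<Rightarrow> 'a set set \<Rightarrow> bool" where
  "simple_graph V E \<longleftrightarrow> finite V \<and> (\<forall>e\<in>E. \<exists>u\<in>V. \<exists>v\<in>V. u \<noteq> v \<and> e = {u, v})"

definition induces_connected :: "'a set set \<Rightarrow> 'a set \<Rightarrow> bool" where
  "induces_connected E S \<longleftrightarrow>
     S \<noteq> {} \<and> (\<forall>u\<in>S. \<forall>v\<in>S. (u, v) \<in> {(x, y). x \<in> S \<and> y \<in> S \<and> {x, y} \<in> E}\<^sup>*)"

definition is_cycle :: "'a set set \<Rightarrow> 'a list \<Rightarrow> bool" where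
  "is_cycle E vs \<longleftrightarrow> 3 \<le> length vs \<and> distinct vs \<and>
     (\<forall>i < length vs. {vs ! i, vs ! (Suc i mod length vs)} \<in> E)"

definition is_tree :: "'a set \<Rightarrow> 'a set set \<Rightarrow> bool" where
  "is_tree V E \<longleftrightarrow> simple_graph V E \<and> induces_connected E V \<and> (\<nexists>vs. is_cycle E vs)"

section \<open>The assignment problem for connected k-center with disjoint clusters\<close>

text \<open>The centers are \<open>c 0, \<dots>, c (k - 1)\<close> and the clusters are \<open>C 0, \<dots>, C (k - 1)\<close>.\<close>

definition assignment_instance ::
    "'a set \<Rightarrow> 'a set set \<Rightarrow> ('a \<Rightarrow> 'a \<Rightarrow> real) \<Rightarrow> nat \<Rightarrow> (nat \<Rightarrow> 'a) \<Rightarrow> bool" where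
  "assignment_instance V E d k c \<longleftrightarrow>
     simple_graph V E \<and> Metric_space V d \<and> 1 \<le> k \<and> inj_on c {..<k} \<and> c ` {..<k} \<subseteq> V"

definition feasible_clusters ::
    "'a set \<Rightarrow> 'a set set \<Rightarrow> nat \<Rightarrow> (nat \<Rightarrow> 'a) \<Rightarrow> (nat \<Rightarrow> 'a set) \<Rightarrow> bool" where
  "feasible_clusters V E k c C \<longleftrightarrow>
     (\<Union>i<k. C i) = V \<and> disjoint_family_on C {..<k} \<and>
     (\<forall>i<k. c i \<in> C i \<and> induces_connected E (C i))"

definition clustering_radius ::
    "('a \<Rightarrow> 'a \<Rightarrow> real) \<Rightarrow> nat \<Rightarrow> (nat \<Rightarrow> 'a) \<Rightarrow> (nat \<Rightarrow> 'a set) \<Rightarrow> real" where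
  "clustering_radius d k c C = (MAX i\<in>{..<k}. MAX x\<in>C i. d x (c i))"

definition optimal_clusters ::
    "'a set \<Rightarrow> 'a set set \<Rightarrow> ('a \<Rightarrow> 'a \<Rightarrow> real) \<Rightarrow> nat \<Rightarrow> (nat \<Rightarrow> 'a) \<Rightarrow> (nat \<Rightarrow> 'a set) \<Rightarrow> bool"
where
  "optimal_clusters V E d k c C \<longleftrightarrow>
     feasible_clusters V E k c C \<and>
     (\<forall>C'. feasible_clusters V E k c C' \<longrightarrow> clustering_radius d k c C \<le> clustering_radius d k c C')"

section \<open>A word RAM with real-valued cells\<close>

text \<open>Algorithms are programs of a small imperative language over finitely many named,
  randomly accessible arrays: arrays of machine words, and arrays of reals. Reals can only be
  copied and compared. Words are naturals up to a largest word \<open>W\<close>: an expression with a constant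
  or an arithmetic result above \<open>W\<close> has no value, and the program containing it gets stuck.
  The bound keeps unit-cost arithmetic from being abused on huge numbers.\<close>

datatype expr =
    Const nat
  | Read string expr
  | Plus expr expr
  | Minus expr expr
  | Times expr expr
  | Div expr expr

datatype test =
    Less expr expr
  | Real_Less string expr string expr  \<comment> \<open>\<open>Real_Less a i b j\<close> tests \<open>a[i] < b[j]\<close>\<close>
  | Neg test
  | Conj test test

datatype program =
    Skip
  | Write string expr expr             \<comment> \<open>\<open>Write a i e\<close> is \<open>a[i] := e\<close>\<close>
  | Real_Copy string expr string expr  \<comment> \<open>\<open>Real_Copy a i b j\<close> is \<open>a[i] := b[j]\<close>\<close>
  | Seq program program
  | Cond test program program
  | While test program

record store =
  words :: "string \<Rightarrow> nat \<Rightarrow> nat"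
  reals :: "string \<Rightarrow> nat \<Rightarrow> real"

definition word :: "nat \<Rightarrow> nat \<Rightarrow> nat option" where
  "word W x = (if x \<le> W then Some x else None)"

definition word_op :: "nat \<Rightarrow> (nat \<Rightarrow> nat \<Rightarrow> nat) \<Rightarrow> nat option \<Rightarrow> nat option \<Rightarrow> nat option" where
  "word_op W f p q = Option.bind p (\<lambda>x. Option.bind q (\<lambda>y. word W (f x y)))"

text \<open>Subtraction is truncated at \<open>0\<close>, and division by \<open>0\<close> yields \<open>0\<close>.\<close>

fun eval_expr :: "nat \<Rightarrow> store \<Rightarrow> expr \<Rightarrow> nat option" where
  "eval_expr W s (Const x) = word W x"
| "eval_expr W s (Read a e) = map_option (words s a) (eval_expr W s e)"
| "eval_expr W s (Plus e f) = word_op W (+) (eval_expr W s e) (eval_expr W s f)"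
| "eval_expr W s (Minus e f) = word_op W (-) (eval_expr W s e) (eval_expr W s f)"
| "eval_expr W s (Times e f) = word_op W (*) (eval_expr W s e) (eval_expr W s f)"
| "eval_expr W s (Div e f) = word_op W (div) (eval_expr W s e) (eval_expr W s f)"

fun eval_test :: "nat \<Rightarrow> store \<Rightarrow> test \<Rightarrow> bool option" where
  "eval_test W s (Less e f) =
     Option.bind (eval_expr W s e) (\<lambda>x. map_option (\<lambda>y. x < y) (eval_expr W s f))"
| "eval_test W s (Real_Less a i b j) =
     Option.bind (eval_expr W s i)
       (\<lambda>x. map_option (\<lambda>y. reals s a x < reals s b y) (eval_expr W s j))"
| "eval_test W s (Neg b) = map_option Not (eval_test W s b)"
| "eval_test W s (Conj b b') =
     Option.bind (eval_test W s b) (\<lambda>x. map_option (\<lambda>y. x \<and> y) (eval_test W s b'))"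

text \<open>\<open>runs W P s t s'\<close>: started in the store \<open>s\<close>, the program \<open>P\<close> terminates in the store \<open>s'\<close>
  after \<open>t\<close> steps. Each executed assignment and each evaluated branching condition is one step;
  the sizes of the expressions involved are fixed by the program, hence bounded by a constant.\<close>

inductive runs :: "nat \<Rightarrow> program \<Rightarrow> store \<Rightarrow> nat \<Rightarrow> store \<Rightarrow> bool" for W where
  Skip: "runs W Skip s 1 s"
| Write: "eval_expr W s i = Some x \<Longrightarrow> eval_expr W s e = Some y \<Longrightarrow>
    runs W (Write a i e) s 1 (s\<lparr>words := (words s)(a := (words s a)(x := y))\<rparr>)"
| Real_Copy: "eval_expr W s i = Some x \<Longrightarrow> eval_expr W s j = Some y \<Longrightarrow>
    runs W (Real_Copy a i b j) s 1 (s\<lparr>reals := (reals s)(a := (reals s a)(x := reals s b y))\<rparr>)"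
| Seq: "runs W P s t s' \<Longrightarrow> runs W Q s' t' s'' \<Longrightarrow> runs W (Seq P Q) s (t + t') s''"
| Cond_True: "eval_test W s b = Some True \<Longrightarrow> runs W P s t s' \<Longrightarrow>
    runs W (Cond b P Q) s (1 + t) s'"
| Cond_False: "eval_test W s b = Some False \<Longrightarrow> runs W Q s t s' \<Longrightarrow>
    runs W (Cond b P Q) s (1 + t) s'"
| While_False: "eval_test W s b = Some False \<Longrightarrow> runs W (While b P) s 1 s"
| While_True: "eval_test W s b = Some True \<Longrightarrow> runs W P s t s' \<Longrightarrow> runs W (While b P) s' t' s'' \<Longrightarrow>
    runs W (While b P) s (1 + t + t') s''"

inductive_cases runs_SkipE: "runs W Skip s t s'"
inductive_cases runs_WriteE: "runs W (Write a i e) s t s'"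
inductive_cases runs_Real_CopyE: "runs W (Real_Copy a i b j) s t s'"
inductive_cases runs_SeqE: "runs W (Seq P Q) s t s'"
inductive_cases runs_CondE: "runs W (Cond b P Q) s t s'"
inductive_cases runs_WhileE: "runs W (While b P) s t s'"

lemma runs_deterministic:
  "runs W P s t s' \<Longrightarrow> runs W P s u s'' \<Longrightarrow> u = t \<and> s'' = s'"
proof (induction arbitrary: u s'' rule: runs.induct)
  case (Skip s)
  then show ?case
    by (rule runs_SkipE) simp
next
  case (Write s i x e y a)
  from Write.prems show ?case
    by (rule runs_WriteE) (simp add: Write.hyps)
next
  case (Real_Copy s i x j y a b)
  from Real_Copy.prems show ?case
    by (rule runs_Real_CopyE) (simp add: Real_Copy.hyps)
next
  case (Seq P s t s1 Q t' s2)
  from Seq.prems obtain v r v' where u: "u = v + v'"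
    and P: "runs W P s v r" and Q: "runs W Q r v' s''"
    by (rule runs_SeqE)
  from Seq.IH(1)[OF P] have r: "v = t" "r = s1" by simp_all
  from Seq.IH(2)[OF Q[unfolded r]] show ?case by (simp add: u r)
next
  case (Cond_True s b P t s' Q)
  from Cond_True.prems show ?case
    by (rule runs_CondE) (simp_all add: Cond_True.hyps Cond_True.IH)
next
  case (Cond_False s b Q t s' P)
  from Cond_False.prems show ?case
    by (rule runs_CondE) (simp_all add: Cond_False.hyps Cond_False.IH)
next
  case (While_False s b P)
  from While_False.prems show ?case
    by (rule runs_WhileE) (simp_all add: While_False.hyps)
next
  case (While_True s b P t s1 t' s2)
  from While_True.prems obtain v r v' where u: "u = Suc (v + v')"
    and P: "runs W P s v r" and Q: "runs W (While b P) r v' s''"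
    by (rule runs_WhileE) (simp_all add: While_True.hyps)
  from While_True.IH(1)[OF P] have r: "v = t" "r = s1" by simp_all
  from While_True.IH(2)[OF Q[unfolded r]] show ?case by (simp add: u r)
qed

section \<open>Input and output\<close>

text \<open>The points are numbered \<open>0, \<dots>, n - 1\<close>. The graph is handed over as a list of its
  edges in arbitrary order, each edge being listed once, with its end points in arbitrary order.\<close>

definition lists_edges :: "('a \<times> 'a) list \<Rightarrow> 'a set set \<Rightarrow> bool" where
  "lists_edges es E \<longleftrightarrow> length es = card E \<and> (\<lambda>(u, v). {u, v}) ` set es = E"

text \<open>The metric is stored in row-major order; all cells not holding input are \<open>0\<close>.\<close>

definition input_store ::
    "nat \<Rightarrow> (nat \<times> nat) list \<Rightarrow> (nat \<Rightarrow> nat \<Rightarrow> real) \<Rightarrow> nat \<Rightarrow> (nat \<Rightarrow> nat) \<Rightarrow> store" where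
  "input_store n es d k c =
     \<lparr>words = (\<lambda>a i.
        if a = ''n'' \<and> i = 0 then n
        else if a = ''k'' \<and> i = 0 then k
        else if a = ''edges'' \<and> i = 0 then length es
        else if a = ''source'' \<and> i < length es then fst (es ! i)
        else if a = ''target'' \<and> i < length es then snd (es ! i)
        else if a = ''center'' \<and> i < k then c i
        else 0),
      reals = (\<lambda>a i. if a = ''dist'' \<and> i < n * n then d (i div n) (i mod n) else 0)\<rparr>"

text \<open>On termination, cell \<open>v\<close> of the output array holds the index of the cluster of \<open>v\<close>.\<close>

definition output_clusters :: "nat \<Rightarrow> store \<Rightarrow> nat \<Rightarrow> nat set" where
  "output_clusters n s i = {v. v < n \<and> words s ''cluster'' v = i}"

end

theory Submission
  imports Defs
begin

text \<open>Root the tree at the last vertex that remains when leaves are peeled off one after the other.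
  For a vertex \<open>v\<close> and a cluster index \<open>i\<close> consider the least radius with which the part of the tree
  below \<open>v\<close> can be clustered if \<open>v\<close> belongs to cluster \<open>i\<close>. A child \<open>u\<close> of \<open>v\<close> must belong to cluster
  \<open>i\<close>, too, if center \<open>i\<close> lies below \<open>u\<close>; otherwise it may either join cluster \<open>i\<close> or any cluster
  whose center lies below \<open>u\<close>. So the \<open>n k\<close> values satisfy a min-max recurrence that is evaluated
  bottom-up in time \<open>O(n k)\<close>, without sorting the distances, and a top-down pass reads off an
  optimal clustering. Storing for each vertex the number and the sum of its remaining neighbours
  makes the peeling linear: the sum at a leaf is its only neighbour.\<close>

section \<open>Dynamic programming on a rooted tree\<close>

text \<open>A child's options are limited because the only edge leaving a subtree joins its top
  vertex to the parent: a cluster meeting both sides contains both ends of that edge. Hence a child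
  \<open>u\<close> outside the cluster of its parent \<open>v\<close> lies in a cluster with center
  below \<open>u\<close>, and the cluster of \<open>v\<close> has no center below \<open>u\<close>.
  The best such cluster for \<open>u\<close> does not depend on the index chosen at
  \<open>v\<close>. One scan of the row of \<open>u\<close> thus serves all \<open>k\<close> entries
  of the row of \<open>v\<close>, so the work per edge is O(k) rather than O(k^2). Table entries are
  reasoned about through their upper bounds, as \<open>fits r v i\<close>: infinite entries then
  need no arithmetic, and a maximum over children becomes a conjunction. Every feasible clustering
  of radius at most \<open>r\<close> makes the best root entry fit \<open>r\<close>, and the
  threshold of that entry is inherited by all vertices on the way down; together this gives
  optimality. Without a feasible clustering there would be no root entry to read; that one exists is
  proved separately, for every connected graph.\<close>

abbreviation edge_within :: "'a set set \<Rightarrow> 'a set \<Rightarrow> ('a \<times> 'a) set" where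
  "edge_within E S \<equiv> {(x, y). x \<in> S \<and> y \<in> S \<and> {x, y} \<in> E}"

section \<open>Connected vertex sets and existence of feasible clusterings\<close>

lemma edge_within_rtrancl_sym:
  "(x, y) \<in> (edge_within E S)\<^sup>* \<Longrightarrow> (y, x) \<in> (edge_within E S)\<^sup>*"
proof -
  have "sym (edge_within E S)"
    by (auto simp: sym_def insert_commute)
  then show "(x, y) \<in> (edge_within E S)\<^sup>* \<Longrightarrow> (y, x) \<in> (edge_within E S)\<^sup>*"
    by (meson sym_rtrancl symD)
qed

text \<open>Reachability inside \<open>S\<close> is symmetric, so joining everything to a single hub
  \<open>z\<close> suffices. The hub will be, for instance, a cluster center, the root, or the
  neighbour of a removed leaf.\<close>

lemma induces_connectedI_center:
  assumes "z \<in> S" and "\<And>x. x \<in> S \<Longrightarrow> (x, z) \<in> (edge_within E S)\<^sup>*"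
  shows "induces_connected E S"
  unfolding induces_connected_def
proof (intro conjI ballI)
  fix u v assume "u \<in> S" "v \<in> S"
  then have "(u, z) \<in> (edge_within E S)\<^sup>*" "(z, v) \<in> (edge_within E S)\<^sup>*"
    using assms(2) edge_within_rtrancl_sym[of v z] by blast+
  then show "(u, v) \<in> (edge_within E S)\<^sup>*" by (rule rtrancl_trans)
qed (use assms in auto)

lemma induces_connected_insert:
  assumes S: "induces_connected E S" and x: "x \<in> S" "{x, y} \<in> E"
  shows "induces_connected E (insert y S)"
proof (rule induces_connectedI_center[where z = x])
  fix v assume v: "v \<in> insert y S"
  have mono: "(edge_within E S)\<^sup>* \<subseteq> (edge_within E (insert y S))\<^sup>*"
    by (rule rtrancl_mono) auto
  show "(v, x) \<in> (edge_within E (insert y S))\<^sup>*"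
  proof (cases "v \<in> S")
    case True
    with S x have "(v, x) \<in> (edge_within E S)\<^sup>*"
      by (simp add: induces_connected_def)
    with mono show ?thesis by auto
  next
    case False
    with v x have "(v, x) \<in> edge_within E (insert y S)"
      by (auto simp: insert_commute)
    then show ?thesis by auto
  qed
qed (use x in auto)

text \<open>With \<open>D\<close> the covered vertices this yields an edge along which a cluster can
  grow; with \<open>D\<close> a subtree it yields the edge to the parent.\<close>

lemma rtrancl_crossing:
  assumes "(x, y) \<in> R\<^sup>*" "x \<in> D" "y \<notin> D"
  shows "\<exists>p q. (p, q) \<in> R \<and> p \<in> D \<and> q \<notin> D"
  using assms
proof (induction rule: rtrancl_induct)
  case (step y z)
  then show ?case by (cases "y \<in> D") blast+
qed simp

text \<open>Greedy growth from the singletons \<open>{c i}\<close>: while a vertex is uncovered,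
  connectedness gives an edge from the covered to the uncovered part, and its far end joins the
  cluster of its near end. The lemma later ensures that the search for a cluster of the root
  succeeds.\<close>

lemma feasible_clusters_exist:
  assumes inst: "assignment_instance V E d k c" and conn: "induces_connected E V"
  shows "\<exists>C. feasible_clusters V E k c C"
proof -
  define partial where "partial C \<longleftrightarrow> (\<Union>i<k. C i) \<subseteq> V \<and> disjoint_family_on C {..<k} \<and>
     (\<forall>i<k. c i \<in> C i \<and> induces_connected E (C i))" for C
  have fin: "finite V" and k: "1 \<le> k" and c: "inj_on c {..<k}" "c ` {..<k} \<subseteq> V"
    using inst by (auto simp: assignment_instance_def simple_graph_def)
  have "partial (\<lambda>i. {c i})"
    using c by (auto simp: partial_def disjoint_family_on_def inj_on_def induces_connected_def)
  moreover have "\<exists>C. feasible_clusters V E k c C" if "partial C" for C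
    using that
  proof (induction "card (V - (\<Union>i<k. C i))" arbitrary: C rule: less_induct)
    case less
    let ?U = "\<Union>i<k. C i"
    show ?case
    proof (cases "?U = V")
      case True
      with less.prems show ?thesis
        by (auto simp: partial_def feasible_clusters_def)
    next
      case False
      moreover have "?U \<subseteq> V" using less.prems by (simp add: partial_def)
      ultimately obtain z where z: "z \<in> V" "z \<notin> ?U" by blast
      have "0 < k" using k by simp
      with less.prems c have c0: "c 0 \<in> ?U" "c 0 \<in> V" by (auto simp: partial_def)
      with z conn have "(c 0, z) \<in> (edge_within E V)\<^sup>*" by (simp add: induces_connected_def)
      from rtrancl_crossing[OF this c0(1) z(2)]
      obtain x y where xy: "x \<in> ?U" "y \<in> V" "y \<notin> ?U" "{x, y} \<in> E" by auto
      then obtain i where i: "i < k" "x \<in> C i" by auto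
      let ?C = "C(i := insert y (C i))"
      have U: "(\<Union>j<k. ?C j) = insert y ?U" using i by auto
      have "partial ?C"
        unfolding partial_def U
      proof (intro conjI allI impI)
        show "insert y ?U \<subseteq> V" using less.prems xy by (auto simp: partial_def)
        show "disjoint_family_on ?C {..<k}"
          using less.prems xy by (auto simp: partial_def disjoint_family_on_def)
        fix j assume j: "j < k"
        show "c j \<in> ?C j" using less.prems j by (auto simp: partial_def)
        show "induces_connected E (?C j)"
          using less.prems j induces_connected_insert[OF _ i(2) xy(4)]
          by (simp add: partial_def)
      qed
      moreover have "card (V - (\<Union>j<k. ?C j)) < card (V - ?U)"
        unfolding U using xy fin by (intro psubset_card_mono) auto
      ultimately show ?thesis using less.hyps by blast
    qed
  qed
  ultimately show ?thesis by blast
qed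

text \<open>\<open>MAX\<close> is meaningful only over finite nonempty sets, hence the conditions on
  \<open>k\<close> and \<open>C i\<close>. Afterwards the radius is handled through its upper bounds
  alone.\<close>

lemma clustering_radius_le_iff:
  assumes "1 \<le> k" and "\<And>i. i < k \<Longrightarrow> finite (C i) \<and> C i \<noteq> {}"
  shows "clustering_radius d k c C \<le> r \<longleftrightarrow> (\<forall>i<k. \<forall>x\<in>C i. d x (c i) \<le> r)"
proof -
  have "{..<k} \<noteq> {}" using assms(1) by (metis atLeast0LessThan empty_iff atLeastLessThan_iff less_le_trans zero_less_one le0)
  then show ?thesis
    using assms(2) unfolding clustering_radius_def by auto
qed

text \<open>A rooted tree is encoded by an ordering in which every vertex but the last has its
  parent at a later position. Bottom-up recursion is induction on the position, top-down recursion
  induction on the distance to the end; the value of \<open>par\<close> at the root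
  \<open>ord (n - 1)\<close> is left open.\<close>

locale elimination_order =
  fixes V :: "'a set" and n :: nat and E :: "'a set set" and ord :: "nat \<Rightarrow> 'a" and par :: "'a \<Rightarrow> 'a"
  assumes n_pos: "0 < n"
    and bij: "bij_betw ord {..<n} V"
    and par: "i < n - 1 \<Longrightarrow> \<exists>j. i < j \<and> j < n \<and> par (ord i) = ord j"
    and edges: "E = (\<lambda>i. {ord i, par (ord i)}) ` {..<n - 1}"
begin

lemma ord_inj: "i < n \<Longrightarrow> j < n \<Longrightarrow> ord i = ord j \<longleftrightarrow> i = j"
  using bij by (auto simp: bij_betw_def inj_on_def)

lemma ord_in [simp]: "i < n \<Longrightarrow> ord i \<in> V"
  using bij by (auto simp: bij_betw_def)

lemma ord_surj: "v \<in> V \<Longrightarrow> \<exists>i<n. v = ord i"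
  using bij by (auto simp: bij_betw_def)

abbreviation "child_of \<equiv> {(ord i, par (ord i)) | i. i < n - 1}"

definition desc :: "'a \<Rightarrow> 'a set" where
  "desc u = {x. (x, u) \<in> child_of\<^sup>*}"

text \<open>Passing to a parent increases the position, so descendants can only sit earlier. This
  excludes a parent from the subtree of its child.\<close>

lemma desc_ord:
  assumes "x \<in> desc (ord j)" "j < n"
  shows "\<exists>i\<le>j. x = ord i"
proof -
  have "(x, ord j) \<in> child_of\<^sup>*" using assms(1) by (simp add: desc_def)
  then show ?thesis
  proof (induction rule: converse_rtrancl_induct)
    case (step y z)
    then obtain i i' where i: "i \<le> j" "z = ord i" "i' < n - 1" "y = ord i'" "z = par (ord i')" by auto
    from par[OF i(3)] obtain i'' where "i' < i''" "i'' < n" "z = ord i''" using i by auto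
    with i assms ord_inj[of i'' i] have "i' \<le> j" by auto
    with i show ?case by blast
  qed auto
qed

lemma parent_not_desc:
  assumes "i < n - 1" shows "par (ord i) \<notin> desc (ord i)"
proof
  assume *: "par (ord i) \<in> desc (ord i)"
  from par[OF assms] obtain j where "i < j" "j < n" "par (ord i) = ord j" by blast
  with * desc_ord[of "ord j" i] assms ord_inj show False by fastforce
qed

lemma desc_parent: "i < n - 1 \<Longrightarrow> par (ord i) \<in> desc u \<Longrightarrow> ord i \<in> desc u"
  unfolding desc_def by (auto intro: converse_rtrancl_into_rtrancl)

lemma parent_desc:
  assumes "i < n - 1" "ord i \<in> desc u" "ord i \<noteq> u"
  shows "par (ord i) \<in> desc u"
proof -
  have "(ord i, u) \<in> child_of\<^sup>*" using assms(2) by (simp add: desc_def)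
  then obtain z where z: "(ord i, z) \<in> child_of" "(z, u) \<in> child_of\<^sup>*"
    using assms(3) by (meson converse_rtranclE)
  from z(1) obtain j where j: "j < n - 1" "ord j = ord i" "z = par (ord j)" by auto
  with z(2) show ?thesis by (simp add: desc_def)
qed

text \<open>Some edge of \<open>S\<close> leaves the subtree, and every edge joins a child to its
  parent. The end inside must be the child, and since its parent lies outside, it must be
  \<open>u\<close> itself.\<close>

lemma connected_leaves_desc:
  assumes S: "induces_connected E S" and x: "x \<in> S" "x \<in> desc u" and y: "y \<in> S" "y \<notin> desc u"
  shows "u \<in> S \<and> par u \<in> S"
proof -
  have "(x, y) \<in> (edge_within E S)\<^sup>*" using S x y by (simp add: induces_connected_def)
  from rtrancl_crossing[OF this x(2) y(2)] obtain p q where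
    pq: "p \<in> S" "q \<in> S" "{p, q} \<in> E" "p \<in> desc u" "q \<notin> desc u" by auto
  then obtain i where i: "i < n - 1" "{p, q} = {ord i, par (ord i)}" unfolding edges by auto
  then have "p = ord i \<and> q = par (ord i)"
    using pq desc_parent[OF i(1)] by (metis doubleton_eq_iff)
  with parent_desc[OF i(1)] pq show ?thesis by auto
qed

lemma desc_root: "v \<in> V \<Longrightarrow> v \<in> desc (ord (n - 1))"
proof -
  have "ord i \<in> desc (ord (n - 1))" if "i < n" for i
    using that
  proof (induction "n - i" arbitrary: i rule: less_induct)
    case less
    show ?case
    proof (cases "i = n - 1")
      case False
      with less have i: "i < n - 1" by auto
      from par[OF i] obtain j where "i < j" "j < n" "par (ord i) = ord j" by blast
      with less desc_parent[OF i] show ?thesis by simp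
    qed (simp add: desc_def)
  qed
  then show "v \<in> V \<Longrightarrow> v \<in> desc (ord (n - 1))" using ord_surj by auto
qed

end

text \<open>\<open>fits r v i\<close> says that the part of the tree below \<open>v\<close> can be clustered with radius at most
  \<open>r\<close> when \<open>v\<close> belongs to cluster \<open>i\<close>; \<open>inside v i\<close> that center \<open>i\<close> lies below \<open>v\<close>. If the parent
  of \<open>v\<close> is put into cluster \<open>i\<close>, then \<open>v\<close> is put into cluster \<open>choice v i\<close>.\<close>

locale assignment_tables = elimination_order V n E ord par
  for V :: "'a set" and n E ord par +
  fixes d :: "'a \<Rightarrow> 'a \<Rightarrow> real" and k :: nat and c :: "nat \<Rightarrow> 'a"
    and inside :: "'a \<Rightarrow> nat \<Rightarrow> bool" and fits :: "real \<Rightarrow> 'a \<Rightarrow> nat \<Rightarrow> bool"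
    and choice :: "'a \<Rightarrow> nat \<Rightarrow> nat" and best :: nat
  assumes inst: "assignment_instance V E d k c"
    and inside_iff: "v \<in> V \<Longrightarrow> i < k \<Longrightarrow>
      inside v i \<longleftrightarrow> v = c i \<or> (\<exists>j<n - 1. par (ord j) = v \<and> inside (ord j) i)"
    and fits_iff: "v \<in> V \<Longrightarrow> i < k \<Longrightarrow>
      fits r v i \<longleftrightarrow> (\<forall>j<k. c j = v \<longrightarrow> j = i) \<and> d v (c i) \<le> r \<and>
        (\<forall>j<n - 1. par (ord j) = v \<longrightarrow> fits r (ord j) (choice (ord j) i))"
    and choice_less: "j < n - 1 \<Longrightarrow> i < k \<Longrightarrow> choice (ord j) i < k"
    and choice_cases: "j < n - 1 \<Longrightarrow> i < k \<Longrightarrow> choice (ord j) i = i \<or>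
      \<not> inside (ord j) i \<and> inside (ord j) (choice (ord j) i)"
    and choice_keep: "j < n - 1 \<Longrightarrow> i < k \<Longrightarrow> fits r (ord j) i \<Longrightarrow> fits r (ord j) (choice (ord j) i)"
    and choice_change: "j < n - 1 \<Longrightarrow> i < k \<Longrightarrow> i' < k \<Longrightarrow> \<not> inside (ord j) i \<Longrightarrow>
      inside (ord j) i' \<Longrightarrow> fits r (ord j) i' \<Longrightarrow> fits r (ord j) (choice (ord j) i)"
    and best_root: "i < k \<Longrightarrow> inside (ord (n - 1)) i \<Longrightarrow> fits r (ord (n - 1)) i \<Longrightarrow>
      best < k \<and> fits r (ord (n - 1)) best"
begin

lemma k_pos: "1 \<le> k" and c_in: "i < k \<Longrightarrow> c i \<in> V"
  and finite_V: "finite V"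
  using inst by (auto simp: assignment_instance_def simple_graph_def)

text \<open>The recurrence for \<open>inside\<close> relates a vertex to its children only.
  Induction on the position shows that nothing is marked without a center below it; induction along
  the chain of parents from \<open>c i\<close> shows that the mark travels up.\<close>

lemma inside_iff_desc:
  assumes "v \<in> V" "i < k"
  shows "inside v i \<longleftrightarrow> c i \<in> desc v"
proof
  have "inside (ord l) i \<Longrightarrow> c i \<in> desc (ord l)" if "l < n" for l
    using that
  proof (induction l rule: less_induct)
    case (less l)
    from less.prems inside_iff[of "ord l" i] assms consider "ord l = c i"
      | j where "j < n - 1" "par (ord j) = ord l" "inside (ord j) i" by auto
    then show ?case
    proof cases
      case (2 j)
      with par[of j] ord_inj less.prems have "j < l" by metis
      with 2 less have "(c i, ord j) \<in> child_of\<^sup>*" by (simp add: desc_def)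
      moreover have "(ord j, ord l) \<in> child_of" using 2 by force
      ultimately show ?thesis unfolding desc_def by (auto intro: rtrancl_into_rtrancl)
    qed (simp add: desc_def)
  qed
  then show "inside v i \<Longrightarrow> c i \<in> desc v" using ord_surj assms by blast
next
  assume "c i \<in> desc v"
  then have "(c i, v) \<in> child_of\<^sup>*" by (simp add: desc_def)
  then show "inside v i"
  proof (induction rule: rtrancl_induct)
    case base
    then show ?case using inside_iff c_in assms by auto
  next
    case (step y z)
    then obtain j where "j < n - 1" "y = ord j" "z = par (ord j)" by auto
    moreover from this have "z \<in> V" using par[of j] by auto
    ultimately show ?case using inside_iff[of z i] assms step by auto
  qed
qed

text \<open>Bottom-up induction: the given clustering witnesses that the entry of each vertex
  \<open>v\<close> at its own cluster \<open>a v\<close> fits \<open>r\<close>. The table may choose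
  another cluster for a child than the clustering does, but its choice fits whatever a permitted
  alternative fits.\<close>

lemma feasible_fits:
  assumes C: "feasible_clusters V E k c C" and r: "clustering_radius d k c C \<le> r"
  shows "\<exists>i<k. fits r (ord (n - 1)) i"
proof -
  have U: "(\<Union>i<k. C i) = V" and disj: "disjoint_family_on C {..<k}"
    and cC: "\<And>i. i < k \<Longrightarrow> c i \<in> C i" and conn: "\<And>i. i < k \<Longrightarrow> induces_connected E (C i)"
    using C by (auto simp: feasible_clusters_def)
  have "finite (C i) \<and> C i \<noteq> {}" if "i < k" for i
    using that U cC finite_V finite_subset[of "C i" V] by blast
  with r k_pos have rad: "d x (c i) \<le> r" if "i < k" "x \<in> C i" for i x
    using that clustering_radius_le_iff[of k C d c r] by blast
  have "\<forall>v\<in>V. \<exists>i. i < k \<and> v \<in> C i" using U by auto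
  then obtain a where a: "\<And>v. v \<in> V \<Longrightarrow> a v < k \<and> v \<in> C (a v)" by metis
  have a_eq: "a v = i" if "v \<in> C i" "v \<in> V" "i < k" for v i
    using that a[of v] disj by (auto simp: disjoint_family_on_def)
  have "fits r (ord l) (a (ord l))" if "l < n" for l
    using that
  proof (induction l rule: less_induct)
    case (less l)
    let ?v = "ord l"
    have v: "?v \<in> V" using less.prems by simp
    have av: "a ?v < k" "?v \<in> C (a ?v)" using a[OF v] by auto
    have "fits r (ord j) (choice (ord j) (a ?v))" if j: "j < n - 1" "par (ord j) = ?v" for j
    proof -
      let ?u = "ord j"
      have "j < l" using par[OF j(1)] ord_inj less.prems j by metis
      then have fu: "fits r ?u (a ?u)" using less by simp
      have u: "?u \<in> V" using j by simp
      have au: "a ?u < k" "?u \<in> C (a ?u)" using a[OF u] by auto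
      show ?thesis
      proof (cases "a ?u = a ?v")
        case True
        with fu choice_keep[OF j(1) av(1)] show ?thesis by simp
      next
        case False
        \<comment> \<open>If the center of the parent's cluster lay below \<open>?u\<close>, that
          cluster would have to pass through \<open>?u\<close> to reach the parent, against
          \<open>a ?u \<noteq> a ?v\<close>.\<close>
        have "\<not> inside ?u (a ?v)"
        proof
          assume "inside ?u (a ?v)"
          then have "c (a ?v) \<in> desc ?u" using inside_iff_desc u av by simp
          then have "?u \<in> C (a ?v)"
            using connected_leaves_desc[OF conn[OF av(1)] cC[OF av(1)], of ?u ?v]
              av parent_not_desc[OF j(1)] j by auto
          with a_eq u av False show False by simp
        qed
        \<comment> \<open>Otherwise the cluster of \<open>?u\<close> must leave the subtree to reach
          its center, and so contains the parent.\<close>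
        moreover have "inside ?u (a ?u)"
        proof (rule ccontr)
          assume "\<not> inside ?u (a ?u)"
          then have "c (a ?u) \<notin> desc ?u" using inside_iff_desc u au by simp
          moreover have "?u \<in> desc ?u" by (simp add: desc_def)
          ultimately have "par ?u \<in> C (a ?u)"
            using connected_leaves_desc[OF conn[OF au(1)], of ?u ?u "c (a ?u)"]
              au cC[OF au(1)] by auto
          with j v a_eq[of ?v "a ?u"] au False show False by simp
        qed
        ultimately show ?thesis
          using choice_change[OF j(1) av(1) au(1)] fu by simp
      qed
    qed
    moreover have "\<forall>j<k. c j = ?v \<longrightarrow> j = a ?v" using a_eq[OF _ v] cC by metis
    moreover have "d ?v (c (a ?v)) \<le> r" using rad av by simp
    ultimately show ?case using fits_iff[OF v av(1)] by blast
  qed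
  with n_pos a[of "ord (n - 1)"] show ?thesis by force
qed

lemma V_connected: "induces_connected E V"
proof (rule induces_connectedI_center)
  show "ord (n - 1) \<in> V" using n_pos by simp
  fix x assume "x \<in> V"
  then have "(x, ord (n - 1)) \<in> child_of\<^sup>*" using desc_root by (simp add: desc_def)
  moreover have "child_of \<subseteq> edge_within E V"
    using par edges by auto (metis ord_in)
  ultimately show "(x, ord (n - 1)) \<in> (edge_within E V)\<^sup>*" by (meson rtrancl_mono subsetD)
qed

lemma inside_root: "i < k \<Longrightarrow> inside (ord (n - 1)) i"
  using inside_iff_desc[of "ord (n - 1)"] desc_root c_in n_pos by simp

lemma best_fits:
  assumes "feasible_clusters V E k c C" "clustering_radius d k c C \<le> r"
  shows "best < k \<and> fits r (ord (n - 1)) best"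
  using feasible_fits[OF assms] best_root inside_root by blast

text \<open>Existence of a feasible clustering enters here: the index read at the root is genuine,
  and not the value \<open>k\<close> by which the program signals that no candidate was
  found.\<close>

lemma best_less: "best < k"
  using feasible_clusters_exist[OF inst V_connected] best_fits by blast

text \<open>\<open>least\<close> provides a threshold \<open>m\<close> of the root entry. Every
  feasible radius is fitted by the root entry, hence is at least \<open>m\<close>; conversely,
  descending by \<open>choice\<close> preserves \<open>fits m\<close>, so each vertex ends up within
  \<open>m\<close> of its center.\<close>

lemma tables_optimal:
  assumes a_root: "a (ord (n - 1)) = best"
    and a_step: "\<And>j. j < n - 1 \<Longrightarrow> a (ord j) = choice (ord j) (a (par (ord j)))"
    and least: "\<exists>m. \<forall>r. fits r (ord (n - 1)) best \<longleftrightarrow> fits m (ord (n - 1)) best \<and> m \<le> r"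
  shows "optimal_clusters V E d k c (\<lambda>i. {v \<in> V. a v = i})"
proof -
  let ?root = "ord (n - 1)" and ?C = "\<lambda>i. {v \<in> V. a v = i}"
  have root: "?root \<in> V" using n_pos by simp
  obtain m where m: "fits r ?root best \<longleftrightarrow> fits m ?root best \<and> m \<le> r" for r
    using least by blast
  have best: "best < k" "fits m ?root best"
    using feasible_clusters_exist[OF inst V_connected] best_fits m by blast+
  have fits: "a (ord i) < k \<and> fits m (ord i) (a (ord i))" if "i < n" for i
    using that
  proof (induction "n - i" arbitrary: i rule: less_induct)
    case less
    show ?case
    proof (cases "i = n - 1")
      case False
      with less have i: "i < n - 1" by auto
      from par[OF i] obtain j where j: "i < j" "j < n" "par (ord i) = ord j" by blast
      with less have "a (ord j) < k" "fits m (ord j) (a (ord j))" by simp_all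
      with i j fits_iff[of "ord j" "a (ord j)" m] have "fits m (ord i) (choice (ord i) (a (ord j)))"
        by simp
      with i j a_step[OF i] choice_less[OF i] \<open>a (ord j) < k\<close> show ?thesis by simp
    qed (use a_root best in simp)
  qed
  have a_less: "a v < k" and a_fits: "fits m v (a v)" if "v \<in> V" for v
    using ord_surj[OF that] fits by auto
  \<comment> \<open>A vertex that is a center fits no cluster but its own, whatever the
    radius.\<close>
  have a_center: "a (c j) = j" if "j < k" for j
    using a_fits[OF c_in[OF that]] a_less[OF c_in[OF that]] fits_iff[of "c j" "a (c j)" m] c_in that by auto
  have edge: "{ord j, par (ord j)} \<in> E" "par (ord j) \<in> V" if "j < n - 1" for j
    using that edges par[OF that] by auto
  \<comment> \<open>If the center lies below a vertex, it is that vertex or lies below one of its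
    children, and \<open>choice\<close> keeps the index there. Following these children builds the
    path.\<close>
  have down: "(ord l, c (a (ord l))) \<in> (edge_within E (?C (a (ord l))))\<^sup>*"
    if "l < n" "inside (ord l) (a (ord l))" for l
    using that
  proof (induction l rule: less_induct)
    case (less l)
    let ?v = "ord l"
    have v: "?v \<in> V" using less by simp
    from inside_iff[OF v a_less[OF v]] less.prems consider "?v = c (a ?v)"
      | j where "j < n - 1" "par (ord j) = ?v" "inside (ord j) (a ?v)" by auto
    then show ?case
    proof cases
      case 1
      then show ?thesis by simp
    next
      case (2 j)
      then have "a (ord j) = a ?v"
        using a_step[of j] choice_cases[of j "a ?v"] a_less[OF v] by auto
      moreover have "j < l" using par[of j] 2 ord_inj less.prems by metis
      ultimately have "(ord j, c (a ?v)) \<in> (edge_within E (?C (a ?v)))\<^sup>*"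
        using less.IH[of j] 2 by simp
      moreover have "(?v, ord j) \<in> edge_within E (?C (a ?v))"
        using 2 v edge[of j] \<open>a (ord j) = a ?v\<close> by (auto simp: insert_commute)
      ultimately show ?thesis by (rule converse_rtrancl_into_rtrancl[rotated])
    qed
  qed
  \<comment> \<open>If the center is not below the vertex, the index was not newly chosen there and
    equals that of the parent. Climbing stops at the root at the latest, which has all centers below
    it, and \<open>down\<close> takes over.\<close>
  have up: "(ord l, c (a (ord l))) \<in> (edge_within E (?C (a (ord l))))\<^sup>*" if "l < n" for l
    using that
  proof (induction "n - l" arbitrary: l rule: less_induct)
    case less
    let ?v = "ord l"
    have v: "?v \<in> V" using less by simp
    show ?case
    proof (cases "inside ?v (a ?v)")
      case True
      with less.prems show ?thesis by (rule down)
    next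
      case False
      then have "l \<noteq> n - 1" using inside_root a_less[OF v] by auto
      with less have l: "l < n - 1" by auto
      from par[OF l] obtain j where j: "l < j" "j < n" "par ?v = ord j" by blast
      have eq: "a ?v = a (ord j)"
        using a_step[OF l] choice_cases[OF l, of "a (ord j)"] False j a_less[of "ord j"] by auto
      with less j have "(ord j, c (a ?v)) \<in> (edge_within E (?C (a ?v)))\<^sup>*" by simp
      moreover have "(?v, ord j) \<in> edge_within E (?C (a ?v))"
        using v j eq edge[OF l] by auto
      ultimately show ?thesis by (rule converse_rtrancl_into_rtrancl[rotated])
    qed
  qed
  have "feasible_clusters V E k c ?C"
    unfolding feasible_clusters_def
  proof (intro conjI allI impI)
    show "(\<Union>i<k. ?C i) = V" using a_less by auto
    show "disjoint_family_on ?C {..<k}" by (auto simp: disjoint_family_on_def)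
    fix i assume i: "i < k"
    show ci: "c i \<in> ?C i" using a_center c_in i by simp
    show "induces_connected E (?C i)"
    proof (rule induces_connectedI_center[OF ci])
      fix x assume "x \<in> ?C i"
      then show "(x, c i) \<in> (edge_within E (?C i))\<^sup>*" using up ord_surj by blast
    qed
  qed
  moreover have "clustering_radius d k c ?C \<le> clustering_radius d k c C'"
    if C': "feasible_clusters V E k c C'" for C'
  proof -
    have "m \<le> clustering_radius d k c C'" using best_fits[OF C' order_refl] m by blast
    moreover have "clustering_radius d k c ?C \<le> m"
    proof (subst clustering_radius_le_iff[OF k_pos])
      show "finite (?C i) \<and> ?C i \<noteq> {}" if "i < k" for i
        using that finite_V a_center c_in by auto
      show "\<forall>i<k. \<forall>x\<in>?C i. d x (c i) \<le> m"
        using a_fits a_less fits_iff by blast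
    qed
    ultimately show ?thesis by simp
  qed
  ultimately show ?thesis by (simp add: optimal_clusters_def)
qed

end

section \<open>Leaf peeling\<close>

abbreviation nbrs :: "'a set set \<Rightarrow> 'a set \<Rightarrow> 'a \<Rightarrow> 'a set" where
  "nbrs E R v \<equiv> {w \<in> R. {v, w} \<in> E}"

text \<open>An end point of a longest path has no second neighbour, which would either prolong the path
  or close a cycle.\<close>

lemma acyclic_has_leaf:
  assumes R: "finite R" "R \<noteq> {}" and acyclic: "\<nexists>vs. is_cycle E vs"
    and loopless: "\<And>v. {v, v} \<notin> E"
  shows "\<exists>u\<in>R. card (nbrs E R u) < 2"
proof -
  define path where "path vs \<longleftrightarrow> vs \<noteq> [] \<and> distinct vs \<and> set vs \<subseteq> R \<and>
    (\<forall>i. Suc i < length vs \<longrightarrow> {vs ! i, vs ! Suc i} \<in> E)" for vs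
  obtain x where x: "x \<in> R" using R by auto
  have "path [x]" using x by (simp add: path_def)
  moreover have "length vs < Suc (card R)" if "path vs" for vs
    using that card_mono[OF R(1), of "set vs"] by (auto simp: path_def distinct_card less_Suc_eq_le)
  ultimately obtain vs where vs: "path vs" and longest: "\<And>ws. path ws \<Longrightarrow> length ws \<le> length vs"
    using ex_has_greatest_nat[of path "[x]" length "Suc (card R)"] by blast
  let ?u = "vs ! 0"
  have u: "?u \<in> R" using vs by (auto simp: path_def)
  have nbr_in: "w \<in> set vs" if w: "w \<in> nbrs E R ?u" for w
  proof (rule ccontr)
    assume "w \<notin> set vs"
    then have "path (w # vs)"
      using vs w by (auto simp: path_def nth_Cons insert_commute split: nat.splits)
    with longest show False by fastforce
  qed
  have nbr_eq: "w = vs ! 1" if w: "w \<in> nbrs E R ?u" for w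
  proof (rule ccontr)
    assume neq: "w \<noteq> vs ! 1"
    from nbr_in[OF w] obtain i where i: "i < length vs" "w = vs ! i" by (auto simp: in_set_conv_nth)
    have "w \<noteq> ?u" using w loopless[of ?u] by auto
    \<comment> \<open>Index at least 2 means that the prefix ending in \<open>w\<close> has three or
      more vertices, as a cycle requires.\<close>
    with neq i have i2: "i \<noteq> 0" "i \<noteq> 1" by metis+
    let ?cyc = "take (Suc i) vs"
    have len: "length ?cyc = Suc i" using i by simp
    have "{?cyc ! j, ?cyc ! (Suc j mod length ?cyc)} \<in> E" if j: "j < length ?cyc" for j
    proof (cases "j = i")
      case True
      with w i len show ?thesis by (simp add: insert_commute)
    next
      case False
      with j len have "j < i" by simp
      with vs i len show ?thesis by (auto simp: path_def)
    qed
    moreover have "3 \<le> length ?cyc" "distinct ?cyc" using i2 len vs by (auto simp: path_def)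
    ultimately have "is_cycle E ?cyc" by (simp add: is_cycle_def)
    with acyclic show False by blast
  qed
  \<comment> \<open>On a path of a single vertex \<open>vs ! 1\<close> is unspecified; the bound
    uses only that all neighbours lie in a one-element set.\<close>
  then have "nbrs E R ?u \<subseteq> {vs ! 1}" by auto
  from card_mono[OF _ this] have "card (nbrs E R ?u) < 2" by simp
  with u show ?thesis by (rule bexI[rotated])
qed

lemma connected_has_nbr:
  assumes conn: "induces_connected E R" and u: "u \<in> R" and x: "x \<in> R" "x \<noteq> u"
  shows "nbrs E R u \<noteq> {}"
proof -
  have "(u, x) \<in> (edge_within E R)\<^sup>*" using assms by (simp add: induces_connected_def)
  with x show ?thesis by (auto elim: converse_rtranclE)
qed

text \<open>Replace each visit to \<open>u\<close> in a walk by a visit to \<open>p\<close>. Steps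
  into \<open>u\<close> come from \<open>p\<close> and steps out of \<open>u\<close> lead to
  \<open>p\<close>, so they become stationary and the walk stays in \<open>R - {u}\<close>.\<close>

lemma connected_remove_leaf:
  assumes conn: "induces_connected E R" and p: "nbrs E R u = {p}" "p \<noteq> u"
  shows "induces_connected E (R - {u})"
proof (rule induces_connectedI_center[where z = p])
  show pR: "p \<in> R - {u}" using p by auto
  fix x assume x: "x \<in> R - {u}"
  have "(p, x) \<in> (edge_within E R)\<^sup>*" using conn x pR by (simp add: induces_connected_def)
  then have "(p, if x = u then p else x) \<in> (edge_within E (R - {u}))\<^sup>*"
  proof (induction rule: rtrancl_induct)
    case (step y z)
    have "(if y = u then p else y, if z = u then p else z) \<in> (edge_within E (R - {u}))\<^sup>*"
    proof (cases "y = u \<or> z = u")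
      case True
      with step.hyps have "y = u \<Longrightarrow> z \<in> nbrs E R u" "z = u \<Longrightarrow> y \<in> nbrs E R u"
        by (auto simp: insert_commute)
      with True p show ?thesis by auto
    next
      case False
      with step.hyps have "(y, z) \<in> edge_within E (R - {u})" by auto
      with False show ?thesis by auto
    qed
    with step.IH show ?case by (rule rtrancl_trans)
  qed simp
  with x have "(p, x) \<in> (edge_within E (R - {u}))\<^sup>*" by simp
  then show "(x, p) \<in> (edge_within E (R - {u}))\<^sup>*" by (rule edge_within_rtrancl_sym)
qed

lemma tree_loopless:
  assumes "is_tree V E" shows "{v, v} \<notin> E"
proof
  assume "{v, v} \<in> E"
  with assms obtain x y where "x \<noteq> y" "{v, v} = {x, y}"
    unfolding is_tree_def simple_graph_def by blast
  then show False by simp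
qed

text \<open>The state of leaf peeling: the queue \<open>q\<close> holds the peeled vertices in the cells below \<open>h\<close>,
  followed in the cells below \<open>t\<close> by the leaves of the remaining tree on \<open>R\<close>.\<close>

definition peeling :: "'a set \<Rightarrow> 'a set set \<Rightarrow> nat \<Rightarrow> (nat \<Rightarrow> 'a) \<Rightarrow> nat \<Rightarrow> ('a \<Rightarrow> 'a) \<Rightarrow> 'a set \<Rightarrow> bool" where
  "peeling V E h q t par R \<longleftrightarrow> h \<le> t \<and> inj_on q {..<t} \<and> R \<subseteq> V \<and> q ` {..<h} = V - R \<and>
     q ` {h..<t} = {v \<in> R. card (nbrs E R v) < 2} \<and> induces_connected E R \<and>
     E = {e \<in> E. e \<subseteq> R} \<union> (\<lambda>i. {q i, par (q i)}) ` {..<h} \<and>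
     (\<forall>i<h. par (q i) \<in> V - q ` {..i})"

lemma peeling_initial:
  assumes tree: "is_tree V E" and q: "inj_on q {..<t}" "q ` {..<t} = {v \<in> V. card (nbrs E V v) < 2}"
  shows "peeling V E 0 q t par V"
proof -
  have "e \<subseteq> V" if "e \<in> E" for e
    using that tree unfolding is_tree_def simple_graph_def by fastforce
  with assms show ?thesis
    by (auto simp: peeling_def is_tree_def atLeast0LessThan)
qed

lemma peeling_card:
  assumes "finite V" "peeling V E h q t par R"
  shows "card R = card V - h" "h \<le> card V" "t \<le> card V"
proof -
  have inj: "inj_on q {..<t}" "h \<le> t" and im: "q ` {..<h} = V - R" "R \<subseteq> V" "q ` {h..<t} \<subseteq> R"
    using assms by (auto simp: peeling_def)
  have "inj_on q {..<h}" using inj by (auto simp: inj_on_def)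
  then have "h = card (V - R)" using card_image im by (metis card_lessThan)
  then show "card R = card V - h" "h \<le> card V"
    using im assms(1) by (auto simp: card_Diff_subset finite_subset card_mono)
  have "{..<t} = {..<h} \<union> {h..<t}" using inj by auto
  then have "q ` {..<t} \<subseteq> V" using im by (auto simp: image_Un)
  from card_mono[OF assms(1) this] show "t \<le> card V" using inj by (simp add: card_image)
qed

text \<open>The queue does not run dry too early: acyclicity yields a remaining vertex of degree
  below 2, which the invariant places in the queue. While two vertices remain, connectedness
  excludes degree 0 for the head.\<close>

lemma peeling_leaf:
  assumes tree: "is_tree V E" and peel: "peeling V E h q t par R" and h: "h < card V - 1"
  obtains p where "h < t" "q h \<in> R" "nbrs E R (q h) = {p}" "p \<noteq> q h"
proof -
  have fin: "finite V" using tree by (simp add: is_tree_def simple_graph_def)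
  with peel have finR: "finite R" by (auto simp: peeling_def finite_subset)
  have card: "1 < card R" using peeling_card[OF fin peel] h by simp
  have "R \<noteq> {}" using card by auto
  with tree obtain u where "u \<in> R" "card (nbrs E R u) < 2"
    using acyclic_has_leaf[OF finR, of E] tree_loopless[OF tree] unfolding is_tree_def by blast
  then have "q ` {h..<t} \<noteq> {}" using peel by (auto simp: peeling_def)
  then have t: "h < t" by simp
  then have "q h \<in> q ` {h..<t}" by simp
  then have qh: "q h \<in> R" "card (nbrs E R (q h)) < 2" using peel by (auto simp: peeling_def)
  obtain x where "x \<in> R" "x \<noteq> q h"
    using card by (metis card_le_Suc0_iff_eq finR leD One_nat_def)
  then have ne: "nbrs E R (q h) \<noteq> {}" using connected_has_nbr[of E R "q h" x] peel qh
    by (auto simp: peeling_def)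
  moreover have "finite (nbrs E R (q h))" using finR by simp
  ultimately have "card (nbrs E R (q h)) \<noteq> 0" by (simp only: card_0_eq not_False_eq_True)
  with qh(2) have "card (nbrs E R (q h)) = 1" by linarith
  then obtain p where p: "nbrs E R (q h) = {p}" by (rule card_1_singletonE)
  with tree_loopless[OF tree] have "p \<noteq> q h" by fastforce
  with that t qh p show ?thesis by blast
qed

lemma nbrs_remove:
  assumes p: "nbrs E R u = {p}" and v: "v \<in> R - {u}"
  shows "nbrs E (R - {u}) v = (if v = p then nbrs E R v - {u} else nbrs E R v)"
    and "u \<in> R \<Longrightarrow> u \<in> nbrs E R p"
proof -
  have *: "{u, w} \<in> E \<longleftrightarrow> w = p" if "w \<in> R" for w using p that by auto
  have "{v, u} \<in> E \<longleftrightarrow> v = p" using *[of v] v by (simp add: insert_commute)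
  then show "nbrs E (R - {u}) v = (if v = p then nbrs E R v - {u} else nbrs E R v)" by auto
  have "{u, p} \<in> E" using p by auto
  then show "u \<in> R \<Longrightarrow> u \<in> nbrs E R p" by (simp add: insert_commute)
qed

text \<open>Among the remaining vertices, removing the leaf \<open>u\<close> lowers the degree of
  \<open>p\<close> only. If it becomes 1, it was 2 and \<open>p\<close> was not yet queued; if it
  becomes 0, \<open>p\<close> was a leaf and is queued already. Testing for exactly 1 therefore
  keeps the queue free of repetitions.\<close>

lemma peeling_step:
  assumes tree: "is_tree V E" and peel: "peeling V E h q t par R" and t: "h < t"
    and u: "u = q h" "u \<in> R" and p: "nbrs E R u = {p}" "p \<noteq> u"
  shows "peeling V E (Suc h)
    (if card (nbrs E (R - {u}) p) = 1 then q(t := p) else q)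
    (if card (nbrs E (R - {u}) p) = 1 then Suc t else t) (par(u := p)) (R - {u})"
proof -
  define push where "push \<longleftrightarrow> card (nbrs E (R - {u}) p) = 1"
  let ?q = "if push then q(t := p) else q"
  let ?t = "if push then Suc t else t"
  have inj: "inj_on q {..<t}" and RV: "R \<subseteq> V" and im: "q ` {..<h} = V - R"
    and leaves: "q ` {h..<t} = {v \<in> R. card (nbrs E R v) < 2}" and conn: "induces_connected E R"
    and E: "E = {e \<in> E. e \<subseteq> R} \<union> (\<lambda>i. {q i, par (q i)}) ` {..<h}"
    and par: "\<forall>i<h. par (q i) \<in> V - q ` {..i}"
    using peel by (auto simp: peeling_def)
  have fin: "finite V" "finite R"
    using tree RV by (auto simp: is_tree_def simple_graph_def finite_subset)
  have pR: "p \<in> R" using p by auto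
  have un: "u \<in> nbrs E R p" using nbrs_remove(2)[OF p(1), of p] pR p u by simp
  then have cardp: "card (nbrs E (R - {u}) p) = card (nbrs E R p) - 1"
    using nbrs_remove(1)[OF p(1), of p] pR p by (simp add: card_Diff_singleton)
  have cardp0: "card (nbrs E R p) \<noteq> 0" using un fin by auto
  have set_t: "{..<t} = {..<h} \<union> {h..<t}" "{h..<t} = insert h {Suc h..<t}" using t by auto
  have new: "p \<notin> q ` {..<t}" if push
  proof
    assume "p \<in> q ` {..<t}"
    then have "p \<in> q ` {h..<t}" using im pR set_t(1) by auto
    with leaves have "card (nbrs E R p) < 2" by simp
    with cardp that show False by (simp add: push_def)
  qed
  have q_eq: "?q i = q i" if "i < t" for i using that by auto
  have inj': "inj_on ?q {..<?t}"
    using inj new by (auto simp: lessThan_Suc inj_on_def)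
  have qh: "q ` {Suc h..<t} = {v \<in> R. card (nbrs E R v) < 2} - {u}"
  proof -
    have "q h \<notin> q ` {Suc h..<t}" using inj t by (fastforce simp: inj_on_def)
    then have "q ` {Suc h..<t} = q ` {h..<t} - {q h}" unfolding set_t(2) by auto
    with leaves u show ?thesis by simp
  qed
  have im': "q ` {..<Suc h} = V - (R - {u})" using im u RV by (auto simp: lessThan_Suc)
  have "?q ` {..<Suc h} = q ` {..<Suc h}" using t q_eq by (intro image_cong) auto
  with im' have A: "?q ` {..<Suc h} = V - (R - {u})" by simp
  have "{v \<in> R - {u}. card (nbrs E (R - {u}) v) < 2} =
      ({v \<in> R. card (nbrs E R v) < 2} - {u}) \<union> (if push then {p} else {})" (is "?L = ?M")
  proof -
    have "v \<in> ?L \<longleftrightarrow> v \<in> ?M" for v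
    proof (cases "v = p")
      case True
      then show ?thesis using cardp cardp0 pR p by (auto simp: push_def)
    next
      case False
      show ?thesis
      proof (cases "v \<in> R - {u}")
        case True
        from nbrs_remove(1)[OF p(1) this] False
        have "nbrs E (R - {u}) v = nbrs E R v" by simp
        with True False show ?thesis by (simp split: if_split)
      next
        case False
        then have "v \<notin> ?L" by simp
        moreover have "v \<notin> ?M" using False \<open>v \<noteq> p\<close> by (simp split: if_split)
        ultimately show ?thesis by (simp only:)
      qed
    qed
    then show ?thesis by (rule set_eqI)
  qed
  moreover have "?q ` {Suc h..<?t} = q ` {Suc h..<t} \<union> (if push then {p} else {})"
  proof -
    have "{Suc h..<?t} = {Suc h..<t} \<union> (if push then {t} else {})" using t by auto
    moreover have "?q ` {Suc h..<t} = q ` {Suc h..<t}" by (intro image_cong) auto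
    ultimately show ?thesis by (simp add: image_Un)
  qed
  ultimately have B: "?q ` {Suc h..<?t} = {v \<in> R - {u}. card (nbrs E (R - {u}) v) < 2}"
    using qh by simp
  have C: "induces_connected E (R - {u})" using connected_remove_leaf[OF conn p] .
  have q_ne: "q i \<noteq> u" if "i < h" for i
  proof -
    have "q i \<in> q ` {..<h}" using that by simp
    with im u show ?thesis by auto
  qed
  have up: "{u, p} \<in> E" using p by auto
  have leafedge: "e = {u, p}" if e: "e \<in> E" "e \<subseteq> R" "u \<in> e" for e
  proof -
    from e(1) tree obtain x y where "e = {x, y}" unfolding is_tree_def simple_graph_def by blast
    with e(3) obtain w where w: "e = {u, w}" by (metis insertE insert_commute singletonD)
    with e have "w \<in> nbrs E R u" by simp
    with w p(1) show ?thesis by simp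
  qed
  have D: "E = {e \<in> E. e \<subseteq> R - {u}} \<union> (\<lambda>i. {?q i, (par(u := p)) (?q i)}) ` {..<Suc h}"
  proof -
    have "(\<lambda>i. {?q i, (par(u := p)) (?q i)}) ` {..<Suc h} =
      (\<lambda>i. {q i, (par(u := p)) (q i)}) ` {..<Suc h}" using t q_eq by (intro image_cong) auto
    also have "\<dots> = insert {u, p} ((\<lambda>i. {q i, (par(u := p)) (q i)}) ` {..<h})"
      using u by (simp add: lessThan_Suc)
    also have "(\<lambda>i. {q i, (par(u := p)) (q i)}) ` {..<h} = (\<lambda>i. {q i, par (q i)}) ` {..<h}"
      using q_ne by (intro image_cong) auto
    finally have 1: "(\<lambda>i. {?q i, (par(u := p)) (?q i)}) ` {..<Suc h} =
      insert {u, p} ((\<lambda>i. {q i, par (q i)}) ` {..<h})" .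
    have 2: "{e \<in> E. e \<subseteq> R} = insert {u, p} {e \<in> E. e \<subseteq> R - {u}}"
      using leafedge up u pR by blast
    show ?thesis unfolding 1 using E 2 by simp
  qed
  have F: "\<forall>i<Suc h. (par(u := p)) (?q i) \<in> V - ?q ` {..i}"
  proof (intro allI impI)
    fix i assume i: "i < Suc h"
    have eq: "?q ` {..i} = q ` {..i}" using t i q_eq by (intro image_cong) auto
    show "(par(u := p)) (?q i) \<in> V - ?q ` {..i}"
    proof (cases "i = h")
      case True
      have "{..i} = {..<Suc h}" using True by auto
      then have "?q ` {..i} = V - (R - {u})" using im' eq by simp
      moreover have "(par(u := p)) (?q i) = p" using True t u q_eq[of h] by simp
      ultimately show ?thesis using pR p RV by auto
    next
      case False
      then show ?thesis using i par q_ne[of i] q_eq[of i] t unfolding eq by auto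
    qed
  qed
  show ?thesis
    unfolding peeling_def push_def[symmetric] 
  proof (intro conjI)
    show "Suc h \<le> ?t" using t by simp
    show "R - {u} \<subseteq> V" using RV by auto
  qed (rule inj' A B C D F)+
qed

text \<open>One vertex remains after \<open>card V - 1\<close> removals. Having degree 0 it also
  belongs to the queue, where it occupies the last cell; so the queue enumerates all of
  \<open>V\<close>, with the root at the end.\<close>

lemma peeling_complete:
  assumes tree: "is_tree V E" and V: "V \<noteq> {}" and peel: "peeling V E (card V - 1) q t par R"
  shows "elimination_order V (card V) E q par"
proof -
  let ?n = "card V"
  have fin: "finite V" using tree by (simp add: is_tree_def simple_graph_def)
  with V have n: "0 < ?n" by (simp add: card_gt_0_iff)
  have card: "card R = 1" "t \<le> ?n" using peeling_card[OF fin peel] n by auto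
  then obtain x where R: "R = {x}" by (auto simp: card_1_singleton_iff)
  have inj: "inj_on q {..<t}" and leaves: "q ` {?n - 1..<t} = {v \<in> R. card (nbrs E R v) < 2}"
    and im: "q ` {..<?n - 1} = V - R" and xV: "x \<in> V"
    and E: "E = {e \<in> E. e \<subseteq> R} \<union> (\<lambda>i. {q i, par (q i)}) ` {..<?n - 1}"
    and par: "\<forall>i<?n - 1. par (q i) \<in> V - q ` {..i}"
    using peel R by (auto simp: peeling_def)
  have "{w. w = x \<and> {x, w} \<in> E} = {}" using tree_loopless[OF tree, of x] by auto
  then have card0: "card (nbrs E R x) = 0" unfolding R by simp
  have "{v \<in> R. card (nbrs E R v) < 2} = {x}"
  proof (intro equalityI subsetI)
    show "v \<in> {v \<in> R. card (nbrs E R v) < 2}" if "v \<in> {x}" for v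
      using that card0 R by (simp only: mem_Collect_eq singleton_iff) simp
  qed (use R in simp)
  with leaves have leaf: "q ` {?n - 1..<t} = {x}" by simp
  then have "{?n - 1..<t} \<noteq> {}" by auto
  with card n have t: "t = ?n" by auto
  then have "{?n - 1..<t} = {?n - 1}" using n by auto
  with leaf have qx: "q (?n - 1) = x" by simp
  have set_n: "{..<?n} = insert (?n - 1) {..<?n - 1}" using n by auto
  have bij: "bij_betw q {..<?n} V"
    unfolding bij_betw_def
  proof
    show "inj_on q {..<?n}" using inj t by simp
    show "q ` {..<?n} = V" unfolding set_n using im qx R xV by auto
  qed
  show ?thesis
  proof
    show "0 < ?n" by (rule n)
    show "bij_betw q {..<?n} V" by (rule bij)
    fix i assume i: "i < ?n - 1"
    with par have "par (q i) \<in> V" "par (q i) \<notin> q ` {..i}" by auto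
    moreover from this(1) bij obtain j where "j < ?n" "par (q i) = q j"
      by (auto simp: bij_betw_def)
    ultimately show "\<exists>j. i < j \<and> j < ?n \<and> par (q i) = q j" by (metis atMost_iff image_eqI leI)
  next
    have "{e \<in> E. e \<subseteq> R} = {}"
    proof -
      have "e = {x} \<or> e = {}" if "e \<subseteq> R" for e using that R by blast
      moreover have "{x} \<notin> E" using tree_loopless[OF tree, of x] by simp
      moreover have "{} \<notin> E" using tree by (auto simp: is_tree_def simple_graph_def)
      ultimately show ?thesis by auto
    qed
    with E show "E = (\<lambda>i. {q i, par (q i)}) ` {..<?n - 1}" by simp
  qed
qed

section \<open>Weakest preconditions with step counts\<close>

text \<open>Total correctness: a terminating run that never gets stuck is asserted along with the
  postcondition, and the postcondition sees the step count. The rules for straight-line code are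
  equivalences, so that rewriting executes programs symbolically.\<close>

definition exec :: "nat \<Rightarrow> program \<Rightarrow> store \<Rightarrow> (nat \<Rightarrow> store \<Rightarrow> bool) \<Rightarrow> bool" where
  "exec W P s Q \<longleftrightarrow> (\<exists>t s'. runs W P s t s' \<and> Q t s')"

definition set_word :: "string \<Rightarrow> nat \<Rightarrow> nat \<Rightarrow> store \<Rightarrow> store" where
  "set_word a i x s = s\<lparr>words := (words s)(a := (words s a)(i := x))\<rparr>"

definition set_real :: "string \<Rightarrow> nat \<Rightarrow> real \<Rightarrow> store \<Rightarrow> store" where
  "set_real a i x s = s\<lparr>reals := (reals s)(a := (reals s a)(i := x))\<rparr>"

lemma set_word_simps [simp]:
  "words (set_word a i x s) b = (if b = a then (words s a)(i := x) else words s b)"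
  "reals (set_word a i x s) = reals s"
  by (auto simp: set_word_def)

lemma set_real_simps [simp]:
  "reals (set_real a i x s) b = (if b = a then (reals s a)(i := x) else reals s b)"
  "words (set_real a i x s) = words s"
  by (auto simp: set_real_def)

lemma exec_mono: "exec W P s Q \<Longrightarrow> (\<And>t s'. Q t s' \<Longrightarrow> Q' t s') \<Longrightarrow> exec W P s Q'"
  unfolding exec_def by blast

lemma exec_Skip: "exec W Skip s Q \<longleftrightarrow> Q 1 s"
  unfolding exec_def by (auto elim!: runs_SkipE intro!: exI runs.Skip)

lemma exec_Write:
  "exec W (Write a i e) s Q \<longleftrightarrow> (case eval_expr W s i of None \<Rightarrow> False | Some x \<Rightarrow>
     (case eval_expr W s e of None \<Rightarrow> False | Some y \<Rightarrow> Q 1 (set_word a x y s)))"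
  unfolding exec_def set_word_def
  by (auto split: option.splits elim!: runs_WriteE intro!: exI runs.Write)

lemma exec_Real_Copy:
  "exec W (Real_Copy a i b j) s Q \<longleftrightarrow> (case eval_expr W s i of None \<Rightarrow> False | Some x \<Rightarrow>
     (case eval_expr W s j of None \<Rightarrow> False | Some y \<Rightarrow> Q 1 (set_real a x (reals s b y) s)))"
  unfolding exec_def set_real_def
  by (auto split: option.splits elim!: runs_Real_CopyE intro!: exI runs.Real_Copy)

lemma exec_Seq: "exec W (Seq P P') s Q \<longleftrightarrow> exec W P s (\<lambda>t s'. exec W P' s' (\<lambda>t'. Q (t + t')))"
  unfolding exec_def by (blast elim: runs_SeqE intro: runs.Seq)

lemma exec_Cond:
  "exec W (Cond b P P') s Q \<longleftrightarrow> (case eval_test W s b of None \<Rightarrow> False | Some x \<Rightarrow>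
     if x then exec W P s (\<lambda>t. Q (1 + t)) else exec W P' s (\<lambda>t. Q (1 + t)))"
proof (cases "eval_test W s b")
  case None
  then show ?thesis unfolding exec_def by (auto elim: runs_CondE)
next
  case (Some x)
  have "runs W (Cond b P P') s u s' \<longleftrightarrow> (\<exists>t. u = 1 + t \<and> runs W (if x then P else P') s t s')" for u s'
    using Some by (cases x) (auto elim!: runs_CondE
      intro: runs.Cond_True[simplified] runs.Cond_False[simplified])
  then show ?thesis unfolding exec_def Some by auto
qed

lemmas exec_simps = exec_Skip exec_Write exec_Real_Copy exec_Seq exec_Cond

text \<open>The number \<open>m\<close> of rounds is known in advance, so no separate termination
  argument is needed. Each round pays for its body and one test; the failing test at the end is the
  leading 1.\<close>

lemma exec_While:
  assumes inv: "I 0 s"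
    and step: "\<And>j s. j < m \<Longrightarrow> I j s \<Longrightarrow> eval_test W s b = Some True \<and>
      exec W P s (\<lambda>t s'. t \<le> T \<and> I (Suc j) s')"
    and stop: "\<And>s. I m s \<Longrightarrow> eval_test W s b = Some False"
  shows "exec W (While b P) s (\<lambda>t s'. t \<le> 1 + m * (T + 1) \<and> I m s')"
proof -
  have "I j s \<Longrightarrow> j \<le> m \<Longrightarrow>
      exec W (While b P) s (\<lambda>t s'. t \<le> 1 + (m - j) * (T + 1) \<and> I m s')" for j s
  proof (induction "m - j" arbitrary: j s)
    case 0
    then show ?case using stop unfolding exec_def by (auto intro!: exI runs.While_False)
  next
    case (Suc l)
    then have j: "j < m" "m - j = Suc (m - Suc j)" by auto
    from step[OF this(1) Suc.prems(1)] obtain t s' where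
      b: "eval_test W s b = Some True" and P: "runs W P s t s'" "t \<le> T" "I (Suc j) s'"
      unfolding exec_def by blast
    from Suc.hyps(1)[of "Suc j" s'] Suc.hyps(2) j P obtain t' s'' where
      "runs W (While b P) s' t' s''" "t' \<le> 1 + (m - Suc j) * (T + 1)" "I m s''"
      unfolding exec_def by auto
    with runs.While_True[OF b P(1)] P(2) j(2) show ?case
      unfolding exec_def by (intro exI[of _ "1 + t + t'"] exI[of _ s'']) simp
  qed
  from this[of 0 s] inv show ?thesis by simp
qed

abbreviation var :: "string \<Rightarrow> expr" where
  "var x \<equiv> Read x (Const 0)"

definition For :: "string \<Rightarrow> expr \<Rightarrow> program \<Rightarrow> program" where
  "For x N P = Seq (Write x (Const 0) (Const 0))
     (While (Less (var x) N) (Seq P (Write x (Const 0) (Plus (var x) (Const 1)))))"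

text \<open>A round costs the body, a test and an increment; initialization and the failing test add
  2. The bound \<open>N\<close> is re-evaluated in every round, so the invariant must determine its
  value. The invariant is demanded of the store in which the counter has already advanced.\<close>

lemma exec_For:
  assumes init: "I 0 (set_word x 0 0 s)"
    and N: "\<And>j s. j \<le> m \<Longrightarrow> I j s \<Longrightarrow> eval_expr W s N = Some m"
    and m: "m \<le> W" "1 \<le> W"
    and step: "\<And>j s. j < m \<Longrightarrow> I j s \<Longrightarrow> words s x 0 = j \<Longrightarrow>
      exec W P s (\<lambda>t s'. t \<le> T \<and> words s' x 0 = j \<and> I (Suc j) (set_word x 0 (Suc j) s'))"
    and post: "\<And>t s'. t \<le> 2 + m * (T + 2) \<Longrightarrow> I m s' \<Longrightarrow> Q t s'"
  shows "exec W (For x N P) s Q"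
proof -
  let ?b = "Less (var x) N" and ?P = "Seq P (Write x (Const 0) (Plus (var x) (Const 1)))"
  let ?I = "\<lambda>j s. I j s \<and> words s x 0 = j"
  have "exec W (While ?b ?P) (set_word x 0 0 s) (\<lambda>t s'. t \<le> 1 + m * (T + 1 + 1) \<and> ?I m s')"
  proof (rule exec_While)
    show "?I 0 (set_word x 0 0 s)" using init by simp
    fix j s assume j: "j < m" and I: "?I j s"
    have "exec W ?P s (\<lambda>t s'. t \<le> T + 1 \<and> ?I (Suc j) s')"
      unfolding exec_Seq
      by (rule exec_mono[OF step[OF j]]) (use I j m in \<open>auto simp: exec_Write word_def word_op_def\<close>)
    then show "eval_test W s ?b = Some True \<and> exec W ?P s (\<lambda>t s'. t \<le> T + 1 \<and> ?I (Suc j) s')"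
      using N[of j s] I j m by (simp add: word_def)
  next
    fix s assume "?I m s"
    then show "eval_test W s ?b = Some False" using N[of m s] m by (simp add: word_def)
  qed
  then show ?thesis
    unfolding For_def exec_Seq
    by (auto simp: exec_Write word_def intro!: post elim!: exec_mono)
qed

lemma word_le [simp]: "x \<le> W \<Longrightarrow> word W x = Some x"
  by (simp add: word_def)

lemma word_op_Some [simp]: "word_op W f (Some x) (Some y) = word W (f x y)"
  by (simp add: word_op_def)

section \<open>Frame conditions for stores\<close>

definition unchanged :: "string set \<Rightarrow> string set \<Rightarrow> store \<Rightarrow> store \<Rightarrow> bool" where
  "unchanged A B s s' \<longleftrightarrow> (\<forall>a. a \<notin> A \<longrightarrow> words s' a = words s a) \<and> (\<forall>a. a \<notin> B \<longrightarrow> reals s' a = reals s a)"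

lemma unchanged_refl [simp]: "unchanged A B s s"
  by (simp add: unchanged_def)

lemma unchanged_set_wordI [simp]:
  "a \<in> A \<Longrightarrow> unchanged A B s s' \<Longrightarrow> unchanged A B s (set_word a i x s')"
  by (auto simp: unchanged_def)

lemma unchanged_set_realI [simp]:
  "a \<in> B \<Longrightarrow> unchanged A B s s' \<Longrightarrow> unchanged A B s (set_real a i x s')"
  by (auto simp: unchanged_def)

lemma unchanged_trans:
  "unchanged A B s s' \<Longrightarrow> unchanged A' B' s' s'' \<Longrightarrow> A \<subseteq> C \<Longrightarrow> A' \<subseteq> C \<Longrightarrow> B \<subseteq> D \<Longrightarrow> B' \<subseteq> D \<Longrightarrow>
    unchanged C D s s''"
  unfolding unchanged_def by (metis subsetD)

lemma unchanged_words: "unchanged A B s s' \<Longrightarrow> a \<notin> A \<Longrightarrow> words s' a = words s a"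
  and unchanged_reals: "unchanged A B s s' \<Longrightarrow> a \<notin> B \<Longrightarrow> reals s' a = reals s a"
  by (simp_all add: unchanged_def)

section \<open>Rooting the input tree\<close>

definition count_edge :: program where
  "count_edge =
    Seq (Write ''x'' (Const 0) (Read ''source'' (var ''e'')))
    (Seq (Write ''y'' (Const 0) (Read ''target'' (var ''e'')))
    (Seq (Write ''deg'' (var ''x'') (Plus (Read ''deg'' (var ''x'')) (Const 1)))
    (Seq (Write ''sum'' (var ''x'') (Plus (Read ''sum'' (var ''x'')) (var ''y'')))
    (Seq (Write ''deg'' (var ''y'') (Plus (Read ''deg'' (var ''y'')) (Const 1)))
         (Write ''sum'' (var ''y'') (Plus (Read ''sum'' (var ''y'')) (var ''x'')))))))"

definition push :: "string \<Rightarrow> program" where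
  "push x = Seq (Write ''order'' (var ''tail'') (var x))
    (Write ''tail'' (Const 0) (Plus (var ''tail'') (Const 1)))"

definition collect_leaf :: program where
  "collect_leaf = Cond (Less (Read ''deg'' (var ''v'')) (Const 2)) (push ''v'') Skip"

definition peel_leaf :: program where
  "peel_leaf =
    Seq (Write ''u'' (Const 0) (Read ''order'' (var ''h'')))
    (Seq (Write ''p'' (Const 0) (Read ''sum'' (var ''u'')))
    (Seq (Write ''parent'' (var ''u'') (var ''p''))
    (Seq (Write ''deg'' (var ''p'') (Minus (Read ''deg'' (var ''p'')) (Const 1)))
    (Seq (Write ''sum'' (var ''p'') (Minus (Read ''sum'' (var ''p'')) (var ''u'')))
    (Cond (Conj (Less (Const 0) (Read ''deg'' (var ''p''))) (Less (Read ''deg'' (var ''p'')) (Const 2)))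
      (push ''p'') Skip)))))"

locale tree_instance =
  fixes n :: nat and E :: "nat set set" and es :: "(nat \<times> nat) list" and d :: "nat \<Rightarrow> nat \<Rightarrow> real"
    and k :: nat and c :: "nat \<Rightarrow> nat" and W :: nat
  assumes inst: "assignment_instance {..<n} E d k c"
    and tree: "is_tree {..<n} E" and es: "lists_edges es E" and W: "(n + 1) ^ 3 \<le> W"
begin

section \<open>Word-size bounds and the input arrays\<close>

lemma k_pos: "1 \<le> k" and c_less [simp]: "i < k \<Longrightarrow> c i < n"
  and c_eq: "i < k \<Longrightarrow> j < k \<Longrightarrow> c i = c j \<longleftrightarrow> i = j"
  using inst by (auto simp: assignment_instance_def inj_on_def)

lemma k_le: "k \<le> n"
proof -
  have "card {..<k} \<le> card {..<n}"
    using inst by (intro card_inj_on_le[of c]) (auto simp: assignment_instance_def)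
  then show ?thesis by simp
qed

lemma n_pos: "1 \<le> n"
  using k_pos k_le by simp

text \<open>Row-major indices, the product \<open>n * k\<close> and sums of neighbours are all of
  order \<open>n * n\<close>. The square \<open>(n + 1) ^ 2\<close> is one short of the bound used
  here; the cube leaves room.\<close>

lemma W_large: "x \<le> n * n + 2 * n + 2 \<Longrightarrow> x \<le> W"
proof -
  have "n * n + 2 * n + 2 \<le> (n + 1) ^ 3"
    using n_pos by (simp add: power3_eq_cube algebra_simps)
  with W show "x \<le> n * n + 2 * n + 2 \<Longrightarrow> x \<le> W" by linarith
qed

lemma W_simps [simp]: "x \<le> n \<Longrightarrow> x \<le> W" "x \<le> n \<Longrightarrow> Suc x \<le> W" "0 < W" "Suc 0 \<le> W" "2 \<le> W"
  using W_large[of 2] by (auto intro!: W_large)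

lemma index_less: "v < n \<Longrightarrow> i < m \<Longrightarrow> v * m + i < n * (m::nat)"
proof -
  assume "v < n" "i < m"
  then have "Suc v * m \<le> n * m" by (intro mult_right_mono) auto
  with \<open>i < m\<close> show ?thesis by simp
qed

lemma index_le_W [simp]:
  assumes "v < n" "m \<le> n" "i \<le> m"
  shows "v * m + i \<le> W" "v * m \<le> W"
proof -
  have "v * m \<le> n * n" using assms by (intro mult_mono) auto
  then show "v * m + i \<le> W" "v * m \<le> W" using assms by (auto intro!: W_large)
qed

definition input :: "store \<Rightarrow> bool" where
  "input s \<longleftrightarrow> words s ''n'' 0 = n \<and> words s ''k'' 0 = k \<and> words s ''edges'' 0 = length es \<and>
    (\<forall>i<length es. words s ''source'' i = fst (es ! i) \<and> words s ''target'' i = snd (es ! i)) \<and>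
    (\<forall>i<k. words s ''center'' i = c i) \<and>
    (\<forall>u<n. \<forall>v<n. reals s ''dist'' (u * n + v) = d u v)"

lemma input_unchanged:
  assumes "input s" "unchanged A B s s'"
    and "A \<inter> {''n'', ''k'', ''edges'', ''source'', ''target'', ''center''} = {}" "''dist'' \<notin> B"
  shows "input s'"
proof -
  have "words s' a = words s a" if "a \<in> {''n'', ''k'', ''edges'', ''source'', ''target'', ''center''}" for a
    using assms(2,3) that by (intro unchanged_words) auto
  moreover have "reals s' ''dist'' = reals s ''dist''" by (rule unchanged_reals[OF assms(2,4)])
  ultimately show ?thesis using assms(1) by (simp add: input_def)
qed

lemma input_simps [simp]:
  assumes "input s"
  shows "words s ''n'' 0 = n" "words s ''k'' 0 = k" "words s ''edges'' 0 = length es"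
    "i < length es \<Longrightarrow> words s ''source'' i = fst (es ! i)"
    "i < length es \<Longrightarrow> words s ''target'' i = snd (es ! i)"
    "i < k \<Longrightarrow> words s ''center'' i = c i"
    "u < n \<Longrightarrow> v < n \<Longrightarrow> reals s ''dist'' (u * n + v) = d u v"
  using assms by (auto simp: input_def)

abbreviation "adj R v \<equiv> nbrs E R v"

lemma edge_in:
  assumes "{x, y} \<in> E" shows "x < n \<and> y < n \<and> x \<noteq> y"
proof -
  from assms tree obtain u v where "u < n" "v < n" "u \<noteq> v" "{x, y} = {u, v}"
    unfolding is_tree_def simple_graph_def by blast
  then show ?thesis by (auto simp: doubleton_eq_iff)
qed

lemma length_es: "length es = card E"
  using es by (simp add: lists_edges_def)

text \<open>A crude count of vertex pairs. The sharp bound \<open>n - 1\<close> is obtained from the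
  elimination order, which is known only after the loop over the edges.\<close>

lemma es_le_W: "length es \<le> W"
proof -
  have "E \<subseteq> (\<lambda>(x, y). {x, y}) ` ({..<n} \<times> {..<n})"
    using tree unfolding is_tree_def simple_graph_def by force
  then have "card E \<le> card ({..<n} \<times> {..<n})"
    by (meson card_image_le card_mono finite_SigmaI finite_imageI finite_lessThan le_trans)
  then show ?thesis by (intro W_large) (simp add: length_es card_cartesian_product)
qed

lemma nbrs_bounds:
  assumes "R \<subseteq> {..<n}"
  shows "card (nbrs F R v) \<le> n" "\<Sum>(nbrs F R v) \<le> n * n"
proof -
  have sub: "nbrs F R v \<subseteq> {..<n}" using assms by auto
  from card_mono[OF _ this] show card: "card (nbrs F R v) \<le> n" by simp
  have "\<Sum>(nbrs F R v) \<le> card (nbrs F R v) * n"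
    using sum_bounded_above[of "nbrs F R v" "\<lambda>x. x" n] sub by fastforce
  also have "\<dots> \<le> n * n" using card by simp
  finally show "\<Sum>(nbrs F R v) \<le> n * n" .
qed

section \<open>Degrees and neighbour sums from the edge list\<close>

definition first_edges :: "nat \<Rightarrow> nat set set" where
  "first_edges j = (\<lambda>(u, v). {u, v}) ` set (take j es)"

lemma first_edges_all: "first_edges (length es) = E"
  using es by (simp add: first_edges_def lists_edges_def)

text \<open>\<open>length es = card E\<close> forces the unordered pairs in the list to be distinct.
  So each listed edge really enlarges the neighbourhoods of its ends, and no degree is counted
  twice.\<close>

lemma first_edges_Suc:
  assumes j: "j < length es"
  shows "first_edges (Suc j) = insert {fst (es ! j), snd (es ! j)} (first_edges j)"
    and "{fst (es ! j), snd (es ! j)} \<in> E"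
    and "{fst (es ! j), snd (es ! j)} \<notin> first_edges j"
proof -
  let ?f = "\<lambda>(u, v). {u, v :: nat}"
  have "es ! j \<in> set es" using j by simp
  then show "{fst (es ! j), snd (es ! j)} \<in> E"
    using es by (force simp: lists_edges_def split: prod.splits)
  show "first_edges (Suc j) = insert {fst (es ! j), snd (es ! j)} (first_edges j)"
    using j by (simp add: first_edges_def take_Suc_conv_app_nth split: prod.splits)
  have "card (set (map ?f es)) = length (map ?f es)" using es by (simp add: lists_edges_def)
  then have "distinct (map ?f (take (Suc j) es))"
    using distinct_take[of "map ?f es" "Suc j"] card_distinct by (metis take_map)
  then have "?f (es ! j) \<notin> ?f ` set (take j es)"
    using j by (simp add: take_Suc_conv_app_nth)
  then show "{fst (es ! j), snd (es ! j)} \<notin> first_edges j"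
    by (simp add: first_edges_def split: prod.splits)
qed

lemma exec_count_edges:
  assumes s0: "input s0" and zero: "\<And>v. words s0 ''deg'' v = 0" "\<And>v. words s0 ''sum'' v = 0"
  shows "exec W (For ''e'' (var ''edges'') count_edge) s0 (\<lambda>t s. t \<le> 2 + length es * 8 \<and>
    unchanged {''e'', ''x'', ''y'', ''deg'', ''sum''} {} s0 s \<and>
    (\<forall>v. words s ''deg'' v = card (adj {..<n} v) \<and> words s ''sum'' v = \<Sum>(adj {..<n} v)))"
  (is "exec _ _ _ ?Q")
proof -
  define N where "N j v = nbrs (first_edges j) {..<n} v" for j v
  define I where "I j s \<longleftrightarrow> unchanged {''e'', ''x'', ''y'', ''deg'', ''sum''} {} s0 s \<and>
    (\<forall>v. words s ''deg'' v = card (N j v) \<and> words s ''sum'' v = \<Sum>(N j v))" for j s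
  have I_input: "input s" if "I j s" for j s
    using that unfolding I_def by (auto intro: input_unchanged[OF s0])
  show ?thesis
  proof (rule exec_For[where m = "length es" and T = 6 and I = I])
    show "I 0 (set_word ''e'' 0 0 s0)" using zero by (simp add: I_def N_def first_edges_def)
    show "eval_expr W s (var ''edges'') = Some (length es)" if "I j s" for j s
      using I_input[OF that] by simp
    show "?Q t s"
      if "t \<le> 2 + length es * (6 + 2)" "I (length es) s" for t s
      using that unfolding I_def N_def first_edges_all by simp
    fix j s assume j: "j < length es" and js: "words s ''e'' 0 = j" and I: "I j s"
    note [simp] = I_input[OF I]
    define x y where "x = fst (es ! j)" and "y = snd (es ! j)"
    note F = first_edges_Suc[OF j, folded x_def y_def]
    have xy: "x < n" "y < n" "x \<noteq> y" using edge_in[OF F(2)] by auto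
    have "j \<le> W" using es_le_W j by simp
    have new: "N (Suc j) v =
        (if v = x then insert y (N j x) else if v = y then insert x (N j y) else N j v)" for v
      unfolding F(1) N_def using xy by (auto simp: doubleton_eq_iff)
    have notin: "y \<notin> N j x" "x \<notin> N j y" using F(3) by (auto simp: N_def insert_commute)
    have fin: "finite (N j v)" for v by (simp add: N_def)
    have new_values: "card (N (Suc j) v) = (if v = x \<or> v = y then card (N j v) + 1 else card (N j v))"
      "\<Sum>(N (Suc j) v) = (if v = x then \<Sum>(N j v) + y else if v = y then \<Sum>(N j v) + x else \<Sum>(N j v))" for v
      unfolding new using notin xy(3) card_insert_disjoint[OF fin] sum.insert[OF fin, of _ _ "\<lambda>z. z"]
      by (cases "v = x"; cases "v = y"; simp only: if_True if_False simp_thms add.commute Suc_eq_plus1)+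
    have card: "card (N j v) + 1 \<le> W" for v using nbrs_bounds(1)[of "{..<n}" v "first_edges j"] by (simp add: N_def)
    have sum: "\<Sum>(N j v) + z \<le> W" if "z < n" for v z
      using nbrs_bounds(2)[of "{..<n}" v "first_edges j"] that by (intro W_large) (simp add: N_def)
    have "exec W count_edge s
     (\<lambda>t s'. t \<le> 6 \<and> words s' ''e'' 0 = j \<and> unchanged {''e'', ''x'', ''y'', ''deg'', ''sum''} {} s0 s' \<and>
       (\<forall>v. words s' ''deg'' v = (if v = x \<or> v = y then card (N j v) + 1 else card (N j v)) \<and>
         words s' ''sum'' v = (if v = x then \<Sum>(N j v) + y else if v = y then \<Sum>(N j v) + x else \<Sum>(N j v))))"
      using I j js xy \<open>j \<le> W\<close> card sum unfolding I_def count_edge_def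
      by (simp add: exec_simps x_def[symmetric] y_def[symmetric])
    then show "exec W count_edge s
      (\<lambda>t s'. t \<le> 6 \<and> words s' ''e'' 0 = j \<and> I (Suc j) (set_word ''e'' 0 (Suc j) s'))"
      by (rule exec_mono) (simp add: I_def new_values)
  qed (use es_le_W in simp_all)
qed

lemma exec_collect_leaves:
  assumes s0: "input s0" and tail: "words s0 ''tail'' 0 = 0"
  shows "exec W (For ''v'' (var ''n'') collect_leaf) s0 (\<lambda>t s. t \<le> 2 + n * 5 \<and>
    unchanged {''v'', ''order'', ''tail''} {} s0 s \<and> inj_on (words s ''order'') {..<words s ''tail'' 0} \<and>
    words s ''order'' ` {..<words s ''tail'' 0} = {v \<in> {..<n}. words s ''deg'' v < 2})"
  (is "exec _ _ _ ?Q")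
proof -
  \<comment> \<open>The last conjunct keeps \<open>tail\<close> so small that its increment is still
    a word.\<close>
  define I where "I j s \<longleftrightarrow> unchanged {''v'', ''order'', ''tail''} {} s0 s \<and>
    inj_on (words s ''order'') {..<words s ''tail'' 0} \<and>
    words s ''order'' ` {..<words s ''tail'' 0} = {v \<in> {..<j}. words s ''deg'' v < 2} \<and>
    words s ''tail'' 0 \<le> j" for j s
  have I_input: "input s" if "I j s" for j s
    using that unfolding I_def by (auto intro: input_unchanged[OF s0])
  show ?thesis
  proof (rule exec_For[where m = n and T = 3 and I = I])
    show "I 0 (set_word ''v'' 0 0 s0)" using tail by (simp add: I_def)
    show "eval_expr W s (var ''n'') = Some n" if "I j s" for j s
      using I_input[OF that] by simp
    show "?Q t s"
      if "t \<le> 2 + n * (3 + 2)" "I n s" for t s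
      using that unfolding I_def by simp
    fix j s assume j: "j < n" and js: "words s ''v'' 0 = j" and I: "I j s"
    define t q D where "t = words s ''tail'' 0" and "q = words s ''order''"
      and "D = {v \<in> {..<j}. words s ''deg'' v < 2}"
    have im: "q ` {..<t} = D" and inj: "inj_on q {..<t}" and t: "t \<le> j"
      using I by (auto simp: I_def t_def q_def D_def)
    have eq: "(q(t := j)) ` {..<t} = q ` {..<t}" by (intro image_cong) auto
    have im': "q(t := j) ` {..<Suc t} = insert j D"
      unfolding lessThan_Suc image_insert eq im by simp
    have "inj_on (q(t := j)) {..<t}" using inj by (auto simp: inj_on_def)
    then have inj': "inj_on (q(t := j)) {..<Suc t}"
      unfolding lessThan_Suc by (simp add: eq im D_def)
    have D': "{v \<in> {..<Suc j}. words s ''deg'' v < 2} = (if words s ''deg'' j < 2 then insert j D else D)"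
      by (auto simp: less_Suc_eq D_def)
    have D_eq: "{v. v < Suc j \<and> words s ''deg'' v < 2} = (if words s ''deg'' j < 2 then insert j D else D)"
      using D' by simp
    show "exec W collect_leaf s
      (\<lambda>t s'. t \<le> 3 \<and> words s' ''v'' 0 = j \<and> I (Suc j) (set_word ''v'' 0 (Suc j) s'))"
      using I j js t im im' inj inj' D_eq unfolding I_def collect_leaf_def push_def
      by (simp add: exec_simps t_def[symmetric] q_def[symmetric] del: fun_upd_image)
  qed simp_all
qed

text \<open>The counters are claimed to be correct only on the remaining vertices: those of a peeled
  vertex become stale and are not consulted again. The set \<open>R\<close> is existentially
  quantified in the invariant, as the program stores the queue but not the set.\<close>

lemma exec_peel_leaves:
  assumes s0: "input s0"
    and counts: "\<And>v. words s0 ''deg'' v = card (adj {..<n} v)" "\<And>v. words s0 ''sum'' v = \<Sum>(adj {..<n} v)"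
    and q: "inj_on (words s0 ''order'') {..<words s0 ''tail'' 0}"
      "words s0 ''order'' ` {..<words s0 ''tail'' 0} = {v \<in> {..<n}. words s0 ''deg'' v < 2}"
  shows "exec W (For ''h'' (Minus (var ''n'') (Const 1)) peel_leaf) s0 (\<lambda>t s. t \<le> 2 + n * 10 \<and>
    unchanged {''h'', ''u'', ''p'', ''parent'', ''deg'', ''sum'', ''order'', ''tail''} {} s0 s \<and>
    elimination_order {..<n} n E (words s ''order'') (words s ''parent''))"
  (is "exec _ _ _ ?Q")
proof -
  define I where "I h s \<longleftrightarrow>
    unchanged {''h'', ''u'', ''p'', ''parent'', ''deg'', ''sum'', ''order'', ''tail''} {} s0 s \<and>
    (\<exists>R. peeling {..<n} E h (words s ''order'') (words s ''tail'' 0) (words s ''parent'') R \<and>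
      (\<forall>v\<in>R. words s ''deg'' v = card (adj R v) \<and> words s ''sum'' v = \<Sum>(adj R v)))" for h s
  have I_input: "input s" if "I j s" for j s
    using that unfolding I_def by (auto intro: input_unchanged[OF s0])
  show ?thesis
  proof (rule exec_For[where m = "n - 1" and T = 8 and I = I])
    have "peeling {..<n} E 0 (words s0 ''order'') (words s0 ''tail'' 0) (words s0 ''parent'') {..<n}"
      using peeling_initial[OF tree q(1)] q(2) counts by simp
    then show "I 0 (set_word ''h'' 0 0 s0)"
      using counts unfolding I_def by (auto intro!: exI[of _ "{..<n}"])
    show "eval_expr W s (Minus (var ''n'') (Const 1)) = Some (n - 1)" if "I j s" for j s
      using I_input[OF that] by simp
    show "?Q t s"
      if t: "t \<le> 2 + (n - 1) * (8 + 2)" and I: "I (n - 1) s" for t s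
    proof -
      have "(n - 1) * (8 + 2) \<le> n * 10" by simp
      with t have "t \<le> 2 + n * 10" by linarith
      moreover have "elimination_order {..<n} n E (words s ''order'') (words s ''parent'')"
      proof -
        from I obtain R where "peeling {..<n} E (card {..<n} - 1) (words s ''order'')
            (words s ''tail'' 0) (words s ''parent'') R"
          unfolding I_def card_lessThan by blast
        from peeling_complete[OF tree _ this] n_pos show ?thesis by (simp add: lessThan_empty_iff)
      qed
      ultimately show ?thesis using I unfolding I_def by simp
    qed
    fix h s assume h: "h < n - 1" and hs: "words s ''h'' 0 = h" and I: "I h s"
    define q t par deg sum where "q = words s ''order''" and "t = words s ''tail'' 0"
      and "par = words s ''parent''" and "deg = words s ''deg''" and "sum = words s ''sum''"
    note defs = q_def[symmetric] t_def[symmetric] par_def[symmetric] deg_def[symmetric] sum_def[symmetric]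
    from I obtain R where peel: "peeling {..<n} E h q t par R"
      and vals: "\<And>v. v \<in> R \<Longrightarrow> deg v = card (adj R v)" "\<And>v. v \<in> R \<Longrightarrow> sum v = \<Sum>(adj R v)"
      unfolding I_def defs by blast
    define u where "u = q h"
    obtain p where p: "h < t" "u \<in> R" "adj R u = {p}" "p \<noteq> u"
      using peeling_leaf[OF tree peel] h unfolding u_def by auto
    have R: "R \<subseteq> {..<n}" using peel by (simp add: peeling_def)
    then have fin: "finite R" by (rule finite_subset) simp
    have pR: "p \<in> R" using p(3) by auto
    have un: "u < n" "p < n" using R pR p(2) by auto
    have t: "t \<le> n" using peeling_card(3)[OF _ peel] by simp
    have sum_u: "sum u = p" using vals(2)[OF p(2)] unfolding p(3) by simp
    let ?R = "R - {u}"
    have u_adj: "u \<in> adj R p" using nbrs_remove(2)[OF p(3), of p] pR p by simp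
    have adj_p: "adj ?R p = adj R p - {u}" using nbrs_remove(1)[OF p(3), of p] pR p by simp
    have deg_p: "deg p - 1 = card (adj ?R p)"
      unfolding adj_p vals(1)[OF pR] using u_adj by (simp only: card_Diff_singleton)
    \<comment> \<open>\<open>u\<close> is one of the summands, so truncated subtraction loses
      nothing.\<close>
    have sum_p: "sum p - u = \<Sum>(adj ?R p)"
      unfolding adj_p vals(2)[OF pR] using sum_diff1_nat[of "\<lambda>x. x" "adj R p" u] u_adj by (simp only: if_True)
    have vals': "(deg(p := deg p - 1)) v = card (adj ?R v)" "(sum(p := sum p - u)) v = \<Sum>(adj ?R v)"
      if v: "v \<in> ?R" for v
    proof -
      have vR: "v \<in> R" using v by simp
      have same: "v \<noteq> p \<Longrightarrow> adj ?R v = adj R v" using nbrs_remove(1)[OF p(3) v] by (simp only: if_False)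
      show "(deg(p := deg p - 1)) v = card (adj ?R v)"
        using deg_p vals(1)[OF vR] same by (cases "v = p") (simp_all only: fun_upd_same fun_upd_other not_False_eq_True)
      show "(sum(p := sum p - u)) v = \<Sum>(adj ?R v)"
        using sum_p vals(2)[OF vR] same by (cases "v = p") (simp_all only: fun_upd_same fun_upd_other not_False_eq_True)
    qed
    have bounds: "deg p \<le> n" "sum p \<le> W"
      using vals[OF pR] nbrs_bounds[OF R, of p E] by (auto intro: W_large)
    \<comment> \<open>The new degree equals 1. The test language has no equality, so the program
      uses two strict comparisons.\<close>
    let ?push = "deg p - 1 = 1"
    have step: "peeling {..<n} E (Suc h) (if ?push then q(t := p) else q) (if ?push then Suc t else t) (par(u := p)) ?R"
      using peeling_step[OF tree peel p(1) u_def p(2,3,4)] unfolding deg_p .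
    let ?Post = "\<lambda>(\<tau> :: nat) s'. \<tau> \<le> 8 \<and> words s' ''h'' 0 = h \<and>
      unchanged {''h'', ''u'', ''p'', ''parent'', ''deg'', ''sum'', ''order'', ''tail''} {} s0 s' \<and>
      words s' ''order'' = (if ?push then q(t := p) else q) \<and>
      words s' ''tail'' 0 = (if ?push then Suc t else t) \<and> words s' ''parent'' = par(u := p) \<and>
      words s' ''deg'' = deg(p := deg p - 1) \<and> words s' ''sum'' = sum(p := sum p - u)"
    have "exec W peel_leaf s ?Post"
      using I hs h un t sum_u bounds unfolding I_def peel_leaf_def push_def
      by (simp add: exec_simps defs u_def[symmetric]) linarith
    then show "exec W peel_leaf s
      (\<lambda>\<tau> s'. \<tau> \<le> 8 \<and> words s' ''h'' 0 = h \<and> I (Suc h) (set_word ''h'' 0 (Suc h) s'))"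
    proof (rule exec_mono, intro conjI)
      fix \<tau> s' assume A: "?Post \<tau> s'"
      show "\<tau> \<le> 8" "words s' ''h'' 0 = h" using A by simp_all
      have "\<forall>v\<in>?R. words s' ''deg'' v = card (adj ?R v) \<and> words s' ''sum'' v = \<Sum>(adj ?R v)"
        using A vals' by presburger
      moreover have "peeling {..<n} E (Suc h) (words s' ''order'') (words s' ''tail'' 0) (words s' ''parent'') ?R"
        using A step by presburger
      ultimately show "I (Suc h) (set_word ''h'' 0 (Suc h) s')"
        unfolding I_def using A by (intro conjI exI[of _ ?R]) (simp_all del: mem_Collect_eq)
    qed
  qed simp_all
qed

end

section \<open>Evaluating the recurrence\<close>

definition cell :: "string \<Rightarrow> expr \<Rightarrow> expr" where
  "cell x e = Plus (Times (var x) (var ''k'')) e"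

definition mark_center :: program where
  "mark_center = Write ''owner'' (Read ''center'' (var ''i'')) (Plus (var ''i'') (Const 1))"

text \<open>Truncated subtraction computes the indicator of \<open>owner[v] = i + 1\<close> as
  \<open>1 - ((owner[v] - (i + 1)) + ((i + 1) - owner[v]))\<close>.\<close>

definition init_cell :: program where
  "init_cell =
    Seq (Write ''v'' (Const 0) (Div (var ''q'') (var ''k'')))
    (Seq (Write ''i'' (Const 0) (Minus (var ''q'') (Times (var ''v'') (var ''k''))))
    (Seq (Real_Copy ''cost'' (var ''q'') ''dist'' (Plus (Times (var ''v'') (var ''n'')) (Read ''center'' (var ''i''))))
    (Seq (Write ''inside'' (var ''q'') (Minus (Const 1)
        (Plus (Minus (Read ''owner'' (var ''v'')) (Plus (var ''i'') (Const 1)))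
              (Minus (Plus (var ''i'') (Const 1)) (Read ''owner'' (var ''v''))))))
      (Write ''blocked'' (var ''q'')
        (Minus (Minus (Const 1) (Minus (Const 1) (Read ''owner'' (var ''v'')))) (Read ''inside'' (var ''q'')))))))"

text \<open>A nonzero entry of \<open>blocked\<close> encodes the value infinity, and \<open>best = k\<close> that no candidate has been
  found. Conjunctions are strict, so the cell \<open>cost[u, k]\<close> of the next row is then read in vain.\<close>

definition scan_cell :: program where
  "scan_cell = Cond
    (Conj (Conj (Less (Const 0) (Read ''inside'' (cell ''u'' (var ''j''))))
                (Less (Read ''blocked'' (cell ''u'' (var ''j''))) (Const 1)))
          (Neg (Conj (Less (var ''best'') (var ''k''))
            (Neg (Real_Less ''cost'' (cell ''u'' (var ''j'')) ''cost'' (cell ''u'' (var ''best'')))))))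
    (Write ''best'' (Const 0) (var ''j'')) Skip"

definition scan :: program where
  "scan = Seq (Write ''best'' (Const 0) (var ''k'')) (For ''j'' (var ''k'') scan_cell)"

text \<open>Cluster \<open>i\<close> is kept if its center lies below \<open>u\<close>, if there is
  no candidate, and on ties. The nested negations say that the candidate wins if entry
  \<open>i\<close> is infinite or strictly larger.\<close>

definition choose_cell :: program where
  "choose_cell =
    Cond (Conj (Conj (Less (Read ''inside'' (cell ''u'' (var ''i''))) (Const 1)) (Less (var ''best'') (var ''k'')))
          (Neg (Conj (Less (Read ''blocked'' (cell ''u'' (var ''i''))) (Const 1))
            (Neg (Real_Less ''cost'' (cell ''u'' (var ''best'')) ''cost'' (cell ''u'' (var ''i'')))))))
      (Write ''a'' (Const 0) (var ''best'')) (Write ''a'' (Const 0) (var ''i''))"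

text \<open>Disjunctions for \<open>inside\<close> and \<open>blocked\<close> and a maximum for
  \<open>cost\<close>: the parent's row already combines the parent itself with the children merged
  earlier, and the selected entry of \<open>u\<close> is added to it.\<close>

definition update_cell :: program where
  "update_cell =
    Seq (Write ''choice'' (cell ''u'' (var ''i'')) (var ''a''))
    (Seq (Cond (Less (Const 0) (Read ''inside'' (cell ''u'' (var ''i''))))
        (Write ''inside'' (cell ''p'' (var ''i'')) (Const 1)) Skip)
    (Seq (Cond (Less (Const 0) (Read ''blocked'' (cell ''u'' (var ''a''))))
        (Write ''blocked'' (cell ''p'' (var ''i'')) (Const 1)) Skip)
      (Cond (Real_Less ''cost'' (cell ''p'' (var ''i'')) ''cost'' (cell ''u'' (var ''a'')))
        (Real_Copy ''cost'' (cell ''p'' (var ''i'')) ''cost'' (cell ''u'' (var ''a''))) Skip)))"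

definition merge_vertex :: program where
  "merge_vertex =
    Seq (Write ''u'' (Const 0) (Read ''order'' (var ''h'')))
    (Seq (Write ''p'' (Const 0) (Read ''parent'' (var ''u'')))
    (Seq scan (For ''i'' (var ''k'') (Seq choose_cell update_cell))))"

definition assign_root :: program where
  "assign_root =
    Seq (Write ''u'' (Const 0) (Read ''order'' (Minus (var ''n'') (Const 1))))
    (Seq scan (Write ''cluster'' (var ''u'') (var ''best'')))"

text \<open>The position \<open>n - 2 - h\<close> runs backwards from the last vertex before the
  root, so a parent has its cluster before its children ask for it.\<close>

definition assign_vertex :: program where
  "assign_vertex =
    Seq (Write ''u'' (Const 0) (Read ''order'' (Minus (Minus (var ''n'') (Const 2)) (var ''h''))))
      (Write ''cluster'' (var ''u'')
        (Read ''choice'' (cell ''u'' (Read ''cluster'' (Read ''parent'' (var ''u''))))))"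

context tree_instance
begin

definition idx :: "nat \<Rightarrow> nat \<Rightarrow> nat" where
  "idx v i = v * k + i"

text \<open>Both columns must be below \<open>k\<close>, because \<open>idx u k\<close> is the first
  cell of row \<open>u + 1\<close>.\<close>

lemma idx_eq [simp]: "i < k \<Longrightarrow> j < k \<Longrightarrow> idx u i = idx v j \<longleftrightarrow> u = v \<and> i = j"
proof
  assume *: "i < k" "j < k" "idx u i = idx v j"
  then have "(u * k + i) div k = (v * k + j) div k" "(u * k + i) mod k = (v * k + j) mod k"
    by (simp_all add: idx_def)
  with * show "u = v \<and> i = j" by simp
qed simp

lemma eval_cell [simp]:
  "words s ''k'' 0 = k \<Longrightarrow> words s x 0 = v \<Longrightarrow> v < n \<Longrightarrow> eval_expr W s e = Some i \<Longrightarrow> i \<le> k \<Longrightarrow>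
    eval_expr W s (cell x e) = Some (idx v i)"
  using k_le by (simp add: cell_def idx_def)

definition ins :: "store \<Rightarrow> nat \<Rightarrow> nat \<Rightarrow> bool" where
  "ins s v i \<longleftrightarrow> 0 < words s ''inside'' (idx v i)"

text \<open>An entry is described by the radii it fits: none if it is blocked, otherwise all from
  \<open>cost\<close> upwards.\<close>

definition fits :: "store \<Rightarrow> real \<Rightarrow> nat \<Rightarrow> nat \<Rightarrow> bool" where
  "fits s r v i \<longleftrightarrow> words s ''blocked'' (idx v i) = 0 \<and> reals s ''cost'' (idx v i) \<le> r"

definition pick :: "store \<Rightarrow> nat \<Rightarrow> nat \<Rightarrow> nat" where
  "pick s v i = words s ''choice'' (idx v i)"

text \<open>Shifting the index by one leaves 0, the initial content, for vertices that are no
  center. Injectivity of \<open>c\<close> protects earlier marks from being overwritten.\<close>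

lemma exec_mark_centers:
  assumes s0: "input s0" and zero: "\<And>v. words s0 ''owner'' v = 0"
  shows "exec W (For ''i'' (var ''k'') mark_center) s0 (\<lambda>t s. t \<le> 2 + k * 3 \<and>
    unchanged {''i'', ''owner''} {} s0 s \<and> (\<forall>i<k. words s ''owner'' (c i) = Suc i) \<and>
    (\<forall>v. v \<notin> c ` {..<k} \<longrightarrow> words s ''owner'' v = 0))"
  (is "exec _ _ _ ?Q")
proof -
  define I where "I j s \<longleftrightarrow> unchanged {''i'', ''owner''} {} s0 s \<and>
    (\<forall>i<j. words s ''owner'' (c i) = Suc i) \<and> (\<forall>v. v \<notin> c ` {..<j} \<longrightarrow> words s ''owner'' v = 0)" for j s
  have I_input: "input s" if "I j s" for j s
    using that unfolding I_def by (auto intro: input_unchanged[OF s0])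
  show ?thesis
  proof (rule exec_For[where m = k and T = 1 and I = I])
    show "I 0 (set_word ''i'' 0 0 s0)" using zero by (simp add: I_def)
    show "eval_expr W s (var ''k'') = Some k" if "I j s" for j s
      using I_input[OF that] by simp
    show "?Q t s"
      if "t \<le> 2 + k * (1 + 2)" "I k s" for t s
      using that unfolding I_def by simp
    fix j s assume j: "j < k" and js: "words s ''i'' 0 = j" and I: "I j s"
    note [simp] = I_input[OF I]
    have "j \<le> n" using j k_le by simp
    have "c i \<noteq> c j" if "i < j" for i using c_eq[of i j] that j by simp
    with I js j \<open>j \<le> n\<close> show "exec W mark_center s
      (\<lambda>t s'. t \<le> 1 \<and> words s' ''i'' 0 = j \<and> I (Suc j) (set_word ''i'' 0 (Suc j) s'))"
      by (auto simp: mark_center_def exec_simps I_def less_Suc_eq lessThan_Suc)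
  qed (use k_le in simp_all)
qed

text \<open>This is the recurrence before any child has been merged. A single counter
  \<open>q\<close> runs over the flattened table, with vertex \<open>q div k\<close> and cluster
  \<open>q mod k\<close>.\<close>

lemma exec_init_tables:
  assumes s0: "input s0" and own: "\<And>i. i < k \<Longrightarrow> words s0 ''owner'' (c i) = Suc i"
    and no_own: "\<And>v. v \<notin> c ` {..<k} \<Longrightarrow> words s0 ''owner'' v = 0"
  shows "exec W (For ''q'' (Times (var ''n'') (var ''k'')) init_cell) s0 (\<lambda>t s. t \<le> 2 + n * k * 7 \<and>
    unchanged {''q'', ''v'', ''i'', ''inside'', ''blocked''} {''cost''} s0 s \<and>
    (\<forall>v<n. \<forall>i<k. (ins s v i \<longleftrightarrow> v = c i) \<and>
      (\<forall>r. fits s r v i \<longleftrightarrow> (\<forall>j<k. c j = v \<longrightarrow> j = i) \<and> d v (c i) \<le> r)))"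
  (is "exec _ _ _ ?Q")
proof -
  define ok where "ok s q \<longleftrightarrow> (0 < words s ''inside'' q \<longleftrightarrow> q div k = c (q mod k)) \<and>
      (words s ''blocked'' q = 0 \<longleftrightarrow> (\<forall>j<k. c j = q div k \<longrightarrow> j = q mod k)) \<and>
      reals s ''cost'' q = d (q div k) (c (q mod k))" for s :: store and q
  define I where "I j s \<longleftrightarrow>
    unchanged {''q'', ''v'', ''i'', ''inside'', ''blocked''} {''cost''} s0 s \<and> (\<forall>q<j. ok s q)" for j s
  have I_input: "input s" if "I j s" for j s
    using that unfolding I_def by (auto intro: input_unchanged[OF s0])
  have "n * k \<le> n * n" using k_le by simp
  then have nk: "n * k \<le> W" by (intro W_large) linarith
  show ?thesis
  proof (rule exec_For[where m = "n * k" and T = 5 and I = I])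
    show "I 0 (set_word ''q'' 0 0 s0)" by (simp add: I_def)
    show "eval_expr W s (Times (var ''n'') (var ''k'')) = Some (n * k)" if "I j s" for j s
      using I_input[OF that] nk by simp
    show "?Q t s"
      if t: "t \<le> 2 + n * k * (5 + 2)" and I: "I (n * k) s" for t s
    proof (intro conjI allI impI)
      fix v i assume "v < n" "i < k"
      then have "ok s (idx v i)" using I index_less unfolding I_def idx_def by simp
      with \<open>i < k\<close> have "(ins s v i \<longleftrightarrow> v = c i) \<and>
        (\<forall>r. fits s r v i \<longleftrightarrow> (\<forall>j<k. c j = v \<longrightarrow> j = i) \<and> d v (c i) \<le> r)"
        unfolding ok_def ins_def fits_def by (simp add: idx_def)
      then show "ins s v i \<longleftrightarrow> v = c i"
        "fits s r v i \<longleftrightarrow> (\<forall>j<k. c j = v \<longrightarrow> j = i) \<and> d v (c i) \<le> r" for r by auto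
    qed (use t I in \<open>simp_all add: I_def\<close>)
    fix q s assume q: "q < n * k" and qs: "words s ''q'' 0 = q" and I: "I q s"
    note [simp] = I_input[OF I]
    define v i where "v = q div k" and "i = q mod k"
    have v: "v < n" unfolding v_def using q by (simp add: less_mult_imp_div_less)
    have i: "i < k" unfolding i_def using k_pos by simp
    have qi: "q - v * k = i" unfolding v_def i_def by (simp add: minus_div_mult_eq_mod)
    have le: "q \<le> W" "v * k \<le> W" "i \<le> W" "i \<le> n" "v * n + c i \<le> W" "v * n \<le> W"
      using q nk i k_le v index_le_W[of v k i] index_le_W[of v n "c i"] less_imp_le[OF c_less[OF i]] by simp_all
    have owner: "words s ''owner'' = words s0 ''owner''"
      using I unfolding I_def by (auto intro: unchanged_words)
    define w where "w = words s0 ''owner'' v"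
    have w_le: "w \<le> n"
    proof (cases "v \<in> c ` {..<k}")
      case True
      then show ?thesis using own k_le by (auto simp: w_def)
    qed (simp add: w_def no_own)
    have w_i: "w = Suc i \<longleftrightarrow> v = c i"
    proof
      assume "w = Suc i"
      then have "v \<in> c ` {..<k}" using no_own unfolding w_def by fastforce
      with own \<open>w = Suc i\<close> show "v = c i" unfolding w_def by auto
    qed (use own i in \<open>simp add: w_def\<close>)
    have w_0: "w = 0 \<longleftrightarrow> (\<forall>j<k. c j \<noteq> v)"
    proof (cases "v \<in> c ` {..<k}")
      case True
      then obtain j where "j < k" "v = c j" by auto
      with own[of j] show ?thesis by (auto simp: w_def)
    next
      case False
      with no_own show ?thesis by (auto simp: w_def)
    qed
    let ?in = "1 - ((w - Suc i) + (Suc i - w))"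
    have in_iff: "0 < ?in \<longleftrightarrow> v = c i" unfolding w_i[symmetric] by linarith
    \<comment> \<open>\<open>1 - (1 - w)\<close> is 1 exactly if \<open>v\<close> is some center;
      subtracting \<open>?in\<close> spares the case of center \<open>i\<close> itself.\<close>
    have blocked_iff: "1 - (1 - w) - ?in = 0 \<longleftrightarrow> (\<forall>j<k. c j = v \<longrightarrow> j = i)"
    proof (cases "w = Suc i")
      case True
      then show ?thesis using w_i c_eq i by auto
    next
      case False
      then have "1 - (1 - w) - ?in = 0 \<longleftrightarrow> w = 0" by auto
      also have "\<dots> \<longleftrightarrow> (\<forall>j<k. c j = v \<longrightarrow> j = i)" unfolding w_0 using False w_i by auto
      finally show ?thesis .
    qed
    have diff_le: "x \<le> W \<Longrightarrow> x - y \<le> W" for x y by simp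
    have sum_le: "w - Suc i + (Suc i - w) \<le> W"
      using w_le le(4) by (intro W_large) linarith
    let ?Post = "\<lambda>(t :: nat) s'. t \<le> 5 \<and> words s' ''q'' 0 = q \<and>
      unchanged {''q'', ''v'', ''i'', ''inside'', ''blocked''} {''cost''} s0 s' \<and>
      words s' ''inside'' = (words s ''inside'')(q := ?in) \<and>
      words s' ''blocked'' = (words s ''blocked'')(q := 1 - (1 - w) - ?in) \<and>
      reals s' ''cost'' = (reals s ''cost'')(q := d v (c i))"
    have "exec W init_cell s ?Post"
      using I qs le v i qi w_le sum_le unfolding I_def init_cell_def
      by (simp add: exec_simps diff_le owner v_def[symmetric] w_def[symmetric])
    then show "exec W init_cell s
      (\<lambda>t s'. t \<le> 5 \<and> words s' ''q'' 0 = q \<and> I (Suc q) (set_word ''q'' 0 (Suc q) s'))"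
    proof (rule exec_mono, intro conjI)
      fix t s' assume A: "?Post t s'"
      show "t \<le> 5" "words s' ''q'' 0 = q" using A by simp_all
      have "ok s' q" using A in_iff blocked_iff unfolding ok_def v_def[symmetric] i_def[symmetric] by simp
      moreover have "ok s' q'" if "q' < q" for q'
        using that A I unfolding I_def ok_def by simp
      ultimately show "I (Suc q) (set_word ''q'' 0 (Suc q) s')"
        using A unfolding I_def ok_def by (simp add: less_Suc_eq)
    qed
  qed (use nk in simp_all)
qed

text \<open>For \<open>b = k\<close> the last conjunct says that no index below \<open>m\<close> is
  both inside and finite. Quantifying over \<open>r\<close> expresses minimality of the candidate
  without comparing costs.\<close>

definition best_upto :: "nat \<Rightarrow> store \<Rightarrow> nat \<Rightarrow> nat \<Rightarrow> bool" where
  "best_upto m s u b \<longleftrightarrow> b \<le> k \<and> (b < k \<longrightarrow> ins s u b \<and> words s ''blocked'' (idx u b) = 0) \<and>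
    (\<forall>i<m. \<forall>r. ins s u i \<longrightarrow> fits s r u i \<longrightarrow> b < k \<and> fits s r u b)"

lemma exec_scan:
  assumes s0: "input s0" and u: "words s0 ''u'' 0 = u" "u < n"
  shows "exec W scan s0 (\<lambda>t s. t \<le> 3 + k * 4 \<and>
    unchanged {''j'', ''best''} {} s0 s \<and> best_upto k s0 u (words s ''best'' 0))"
proof -
  let ?s0 = "set_word ''best'' 0 k s0"
  define I where "I j s \<longleftrightarrow> unchanged {''j'', ''best''} {} s0 s \<and> best_upto j s0 u (words s ''best'' 0)" for j s
  have I_input: "input s" if "I j s" for j s
    using that unfolding I_def by (auto intro: input_unchanged[OF s0])
  have "exec W (For ''j'' (var ''k'') scan_cell) ?s0 (\<lambda>t s. t \<le> 2 + k * 4 \<and> I k s)"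
  proof (rule exec_For[where m = k and T = 2 and I = I])
    show "I 0 (set_word ''j'' 0 0 ?s0)" by (simp add: I_def best_upto_def)
    show "eval_expr W s (var ''k'') = Some k" if "I j s" for j s
      using I_input[OF that] by simp
    fix j s assume j: "j < k" and js: "words s ''j'' 0 = j" and I: "I j s"
    note [simp] = I_input[OF I]
    define b where "b = words s ''best'' 0"
    have b: "best_upto j s0 u b" using I by (simp add: I_def b_def)
    have same: "words s a = words s0 a" if "a \<notin> {''j'', ''best''}" for a
      using I that unfolding I_def by (auto intro: unchanged_words)
    have same_real: "reals s = reals s0"
      using I unfolding I_def unchanged_def by auto
    have us: "words s ''u'' 0 = u" using same[of "''u''"] u by simp
    let ?take = "ins s0 u j \<and> words s0 ''blocked'' (idx u j) < 1 \<and>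
      \<not> (b < k \<and> \<not> reals s0 ''cost'' (idx u j) < reals s0 ''cost'' (idx u b))"
    have step: "best_upto (Suc j) s0 u (if ?take then j else b)"
    proof (cases ?take)
      case True
      have "fits s0 r u j" if "i < j" "ins s0 u i" "fits s0 r u i" for i r
      proof -
        have "b < k \<and> fits s0 r u b" using b that by (auto simp: best_upto_def)
        with True show ?thesis by (simp add: fits_def)
      qed
      with True j show ?thesis by (auto simp: best_upto_def less_Suc_eq)
    next
      case False
      have "b < k \<and> fits s0 r u b" if "ins s0 u j" "fits s0 r u j" for r
        using False b that by (auto simp: best_upto_def fits_def)
      moreover have "(if ?take then j else b) = b" using False by (rule if_not_P)
      ultimately show ?thesis using b by (auto simp: best_upto_def less_Suc_eq)
    qed
    have "exec W scan_cell s (\<lambda>t s'. t \<le> 2 \<and> words s' ''j'' 0 = j \<and>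
      unchanged {''j'', ''best''} {} s0 s' \<and> words s' ''best'' 0 = (if ?take then j else b))"
      using I js j k_le us u(2) b same[of "''inside''"] same[of "''blocked''"]
      unfolding I_def scan_cell_def ins_def
      by (simp add: exec_simps b_def[symmetric] same_real best_upto_def)
    then show "exec W scan_cell s
      (\<lambda>t s'. t \<le> 2 \<and> words s' ''j'' 0 = j \<and> I (Suc j) (set_word ''j'' 0 (Suc j) s'))"
      by (rule exec_mono) (use step in \<open>simp add: I_def\<close>)
  qed (use k_le in simp_all)
  then show ?thesis
    using s0 k_le unfolding scan_def I_def
    by (simp add: exec_simps)
qed

definition chosen :: "store \<Rightarrow> nat \<Rightarrow> nat \<Rightarrow> nat \<Rightarrow> nat" where
  "chosen s u b i = (if words s ''inside'' (idx u i) = 0 \<and> b < k \<and>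
     \<not> (words s ''blocked'' (idx u i) = 0 \<and> \<not> reals s ''cost'' (idx u b) < reals s ''cost'' (idx u i))
   then b else i)"

text \<open>These are the properties of \<open>choice\<close> on which optimality rests. The last
  one holds because the selected entry is no worse than that of \<open>b\<close>, which is no worse
  than any entry \<open>i'\<close> with its center below \<open>u\<close>.\<close>

lemma chosen_props:
  assumes b: "best_upto k s u b" and i: "i < k"
  shows "chosen s u b i < k"
    and "chosen s u b i = i \<or> \<not> ins s u i \<and> ins s u (chosen s u b i)"
    and "fits s r u i \<Longrightarrow> fits s r u (chosen s u b i)"
    and "i' < k \<Longrightarrow> \<not> ins s u i \<Longrightarrow> ins s u i' \<Longrightarrow> fits s r u i' \<Longrightarrow> fits s r u (chosen s u b i)"
proof -
  show "chosen s u b i < k" using i by (simp add: chosen_def)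
  show "chosen s u b i = i \<or> \<not> ins s u i \<and> ins s u (chosen s u b i)"
    using b by (simp add: chosen_def best_upto_def ins_def)
  show "fits s r u (chosen s u b i)" if "fits s r u i"
    using b that by (auto simp: chosen_def best_upto_def fits_def)
  assume i': "i' < k" "\<not> ins s u i" "ins s u i'" "fits s r u i'"
  then have "b < k" "fits s r u b" using b by (auto simp: best_upto_def)
  with i' show "fits s r u (chosen s u b i)" by (auto simp: chosen_def fits_def ins_def)
qed

lemma unchanged_tables:
  assumes "unchanged A B s s'" "A \<inter> {''inside'', ''blocked'', ''choice''} = {}" "''cost'' \<notin> B"
  shows "ins s' = ins s" "fits s' = fits s" "pick s' = pick s"
    "best_upto m s' = best_upto m s" "chosen s' = chosen s"
proof -
  have "words s' a = words s a" if "a \<in> {''inside'', ''blocked'', ''choice''}" for a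
    using assms(1,2) that by (intro unchanged_words) auto
  moreover have "reals s' ''cost'' = reals s ''cost''" by (rule unchanged_reals[OF assms(1,3)])
  ultimately show "ins s' = ins s" "fits s' = fits s" "pick s' = pick s"
    "best_upto m s' = best_upto m s" "chosen s' = chosen s"
    by (simp_all add: fun_eq_iff ins_def fits_def pick_def best_upto_def chosen_def)
qed

text \<open>The effect of merging the first \<open>m\<close> columns of the child \<open>u\<close>
  into its parent \<open>p\<close>. The right-hand sides can refer to the starting store, since the
  entries of row \<open>u\<close> are only read; just its choices are written.\<close>

definition folded :: "nat \<Rightarrow> nat \<Rightarrow> nat \<Rightarrow> nat \<Rightarrow> store \<Rightarrow> store \<Rightarrow> bool" where
  "folded m u p b s s' \<longleftrightarrow> (\<forall>v<n. \<forall>i<k.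
     (ins s' v i \<longleftrightarrow> ins s v i \<or> v = p \<and> i < m \<and> ins s u i) \<and>
     (\<forall>r. fits s' r v i \<longleftrightarrow> fits s r v i \<and> (v = p \<and> i < m \<longrightarrow> fits s r u (chosen s u b i))) \<and>
     pick s' v i = (if v = u \<and> i < m then chosen s u b i else pick s v i))"

lemma exec_fold:
  assumes s0: "input s0" and u: "words s0 ''u'' 0 = u" "u < n" and p: "words s0 ''p'' 0 = p" "p < n"
    and up: "u \<noteq> p" and b: "words s0 ''best'' 0 = b" "b \<le> k"
  shows "exec W (For ''i'' (var ''k'') (Seq choose_cell update_cell)) s0 (\<lambda>t s. t \<le> 2 + k * 11 \<and>
    unchanged {''i'', ''a'', ''choice'', ''inside'', ''blocked''} {''cost''} s0 s \<and> folded k u p b s0 s)"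
  (is "exec _ _ _ ?Q")
proof -
  define I where "I m s \<longleftrightarrow>
    unchanged {''i'', ''a'', ''choice'', ''inside'', ''blocked''} {''cost''} s0 s \<and> folded m u p b s0 s \<and>
    (\<forall>i<k. words s ''inside'' (idx u i) = words s0 ''inside'' (idx u i) \<and>
      words s ''blocked'' (idx u i) = words s0 ''blocked'' (idx u i) \<and>
      reals s ''cost'' (idx u i) = reals s0 ''cost'' (idx u i))" for m s
  have I_input: "input s" if "I j s" for j s
    using that unfolding I_def by (auto intro: input_unchanged[OF s0])
  show ?thesis
  proof (rule exec_For[where m = k and T = 9 and I = I])
    show "I 0 (set_word ''i'' 0 0 s0)"
      by (simp add: I_def folded_def ins_def fits_def pick_def)
    show "eval_expr W s (var ''k'') = Some k" if "I j s" for j s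
      using I_input[OF that] by simp
    show "?Q t s" if "t \<le> 2 + k * (9 + 2)" "I k s" for t s
      using that unfolding I_def by simp
    fix m s assume m: "m < k" and ms: "words s ''i'' 0 = m" and I: "I m s"
    note [simp] = I_input[OF I]
    have same: "words s a = words s0 a" if "a \<notin> {''i'', ''a'', ''choice'', ''inside'', ''blocked''}" for a
      using I that unfolding I_def by (auto intro: unchanged_words)
    have us: "words s ''u'' 0 = u" "words s ''p'' 0 = p" "words s ''best'' 0 = b"
      using same u p b by simp_all
    have row: "words s ''inside'' (idx u i) = words s0 ''inside'' (idx u i)"
      "words s ''blocked'' (idx u i) = words s0 ''blocked'' (idx u i)"
      "reals s ''cost'' (idx u i) = reals s0 ''cost'' (idx u i)" if "i < k" for i
      using I that unfolding I_def by simp_all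
    have fold: "folded m u p b s0 s" using I by (simp add: I_def)
    define a where "a = chosen s u b m"
    \<comment> \<open>The selection in the current store agrees with that in the starting store, as
      row \<open>u\<close> is frozen. The case \<open>b = k\<close> is apart because the row facts
      cover only columns below \<open>k\<close>.\<close>
    have a_eq: "a = chosen s0 u b m"
      unfolding a_def chosen_def using row m by (cases "b < k") simp_all
    have a: "a < k" using m by (simp add: a_def chosen_def)
    let ?Post = "\<lambda>(t :: nat) s'. t \<le> 9 \<and> words s' ''i'' 0 = m \<and>
      unchanged {''i'', ''a'', ''choice'', ''inside'', ''blocked''} {''cost''} s0 s' \<and>
      words s' ''choice'' = (words s ''choice'')(idx u m := a) \<and>
      words s' ''inside'' = (if 0 < words s ''inside'' (idx u m)
        then (words s ''inside'')(idx p m := 1) else words s ''inside'') \<and>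
      words s' ''blocked'' = (if 0 < words s ''blocked'' (idx u a)
        then (words s ''blocked'')(idx p m := 1) else words s ''blocked'') \<and>
      reals s' ''cost'' = (if reals s ''cost'' (idx p m) < reals s ''cost'' (idx u a)
        then (reals s ''cost'')(idx p m := reals s ''cost'' (idx u a)) else reals s ''cost'')"
    have "exec W (Seq choose_cell update_cell) s ?Post"
    proof -
      have un: "unchanged {''i'', ''a'', ''choice'', ''inside'', ''blocked''} {''cost''} s0 s"
        using I by (simp add: I_def)
      have "m \<le> n" using m k_le by simp
      moreover have "b \<le> n" using b(2) k_le by simp
      ultimately have "exec W choose_cell s (\<lambda>t s'. t = 2 \<and> s' = set_word ''a'' 0 a s)"
        using ms m us u(2) b(2) unfolding choose_cell_def a_def chosen_def by (simp add: exec_simps)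
      then show ?thesis
        unfolding exec_Seq
      proof (rule exec_mono)
        fix t :: nat and s' assume "t = 2 \<and> s' = set_word ''a'' 0 a s"
        moreover have "m \<le> n" "a \<le> n" using m a k_le by simp_all
        ultimately show "exec W update_cell s' (\<lambda>t'. ?Post (t + t'))"
          using un ms m us u(2) p(2) a unfolding update_cell_def by (simp add: exec_simps)
      qed
    qed
    then show "exec W (Seq choose_cell update_cell) s
      (\<lambda>t s'. t \<le> 9 \<and> words s' ''i'' 0 = m \<and> I (Suc m) (set_word ''i'' 0 (Suc m) s'))"
    proof (rule exec_mono, intro conjI)
      fix t s' assume A: "?Post t s'"
      show "t \<le> 9" "words s' ''i'' 0 = m" using A by simp_all
      have row': "words s' ''inside'' (idx u i) = words s0 ''inside'' (idx u i)"
        "words s' ''blocked'' (idx u i) = words s0 ''blocked'' (idx u i)"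
        "reals s' ''cost'' (idx u i) = reals s0 ''cost'' (idx u i)" if "i < k" for i
        using A row[OF that] that m up by simp_all
      have u_same: "ins s u i = ins s0 u i" "fits s r u i = fits s0 r u i" if "i < k" for i r
        using row[OF that] by (simp_all add: ins_def fits_def)
      have new: "ins s' v i \<longleftrightarrow> ins s v i \<or> v = p \<and> i = m \<and> ins s u m"
        "fits s' r v i \<longleftrightarrow> fits s r v i \<and> (v = p \<and> i = m \<longrightarrow> fits s r u a)"
        "pick s' v i = (if v = u \<and> i = m then a else pick s v i)" if "i < k" for v i r
        using A that m by (auto simp: ins_def fits_def pick_def)
      have "folded (Suc m) u p b s0 s'"
        unfolding folded_def
      proof (intro allI impI)
        fix v i assume v: "v < n" and i: "i < k"
        have old: "ins s v i \<longleftrightarrow> ins s0 v i \<or> v = p \<and> i < m \<and> ins s0 u i"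
          "fits s r v i \<longleftrightarrow> fits s0 r v i \<and> (v = p \<and> i < m \<longrightarrow> fits s0 r u (chosen s0 u b i))"
          "pick s v i = (if v = u \<and> i < m then chosen s0 u b i else pick s0 v i)" for r
          using fold v i unfolding folded_def by blast+
        show "(ins s' v i \<longleftrightarrow> ins s0 v i \<or> v = p \<and> i < Suc m \<and> ins s0 u i) \<and>
          (\<forall>r. fits s' r v i \<longleftrightarrow> fits s0 r v i \<and> (v = p \<and> i < Suc m \<longrightarrow> fits s0 r u (chosen s0 u b i))) \<and>
          pick s' v i = (if v = u \<and> i < Suc m then chosen s0 u b i else pick s0 v i)"
          unfolding new[OF i] old u_same(1)[OF m] u_same(2)[OF a] less_Suc_eq
          using a_eq by auto
      qed
      then show "I (Suc m) (set_word ''i'' 0 (Suc m) s')"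
        unfolding I_def using A row' by (simp add: folded_def ins_def fits_def pick_def)
    qed
  qed (use k_le in simp_all)
qed

text \<open>The budget consists of two writes, \<open>3 + k * 4\<close> for the scan and
  \<open>2 + k * 11\<close> for the merge.\<close>

lemma exec_merge_vertex:
  assumes s0: "input s0" and h: "words s0 ''h'' 0 = h" "h \<le> n"
    and u: "words s0 ''order'' h = u" "u < n" and p: "words s0 ''parent'' u = p" "p < n" and up: "u \<noteq> p"
  shows "exec W merge_vertex s0 (\<lambda>t s. t \<le> 7 + k * 15 \<and>
    unchanged {''u'', ''p'', ''j'', ''best'', ''i'', ''a'', ''choice'', ''inside'', ''blocked''} {''cost''} s0 s \<and>
    (\<exists>b. best_upto k s0 u b \<and> folded k u p b s0 s))"
proof -
  define s1 where "s1 = set_word ''p'' 0 p (set_word ''u'' 0 u s0)"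
  have un1: "unchanged {''u'', ''p''} {} s0 s1" by (simp add: s1_def)
  have s1: "input s1" by (rule input_unchanged[OF s0 un1]) simp_all
  note t1 = unchanged_tables[OF un1, simplified]
  have folded_cong: "folded k u p b s s' = folded k u p b s0 s'"
    if "ins s = ins s0" "fits s = fits s0" "pick s = pick s0" "chosen s = chosen s0" for s s' b
    unfolding folded_def that ..
  have "exec W scan s1 (\<lambda>t s. t \<le> 3 + k * 4 \<and> unchanged {''j'', ''best''} {} s1 s \<and>
    best_upto k s1 u (words s ''best'' 0))"
    by (rule exec_scan[OF s1]) (simp_all add: s1_def u)
  then have "exec W (Seq scan (For ''i'' (var ''k'') (Seq choose_cell update_cell))) s1 (\<lambda>t s. t \<le> 5 + k * 15 \<and>
    unchanged {''u'', ''p'', ''j'', ''best'', ''i'', ''a'', ''choice'', ''inside'', ''blocked''} {''cost''} s0 s \<and>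
    (\<exists>b. best_upto k s0 u b \<and> folded k u p b s0 s))"
    unfolding exec_Seq
  proof (rule exec_mono)
    fix t s assume A: "t \<le> 3 + k * 4 \<and> unchanged {''j'', ''best''} {} s1 s \<and>
      best_upto k s1 u (words s ''best'' 0)"
    then have un2: "unchanged {''j'', ''best''} {} s1 s" by simp
    have s: "input s" by (rule input_unchanged[OF s1 un2]) simp_all
    note t2 = unchanged_tables[OF un2, simplified]
    have bk: "best_upto k s0 u (words s ''best'' 0)" "words s ''best'' 0 \<le> k"
      using A by (simp_all add: t1 best_upto_def)
    have "words s ''u'' 0 = u" "words s ''p'' 0 = p"
      using unchanged_words[OF un2] by (simp_all add: s1_def)
    from exec_fold[OF s this(1) u(2) this(2) p(2) up refl bk(2)]
    show "exec W (For ''i'' (var ''k'') (Seq choose_cell update_cell)) s (\<lambda>t' s'. t + t' \<le> 5 + k * 15 \<and>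
      unchanged {''u'', ''p'', ''j'', ''best'', ''i'', ''a'', ''choice'', ''inside'', ''blocked''} {''cost''} s0 s' \<and>
      (\<exists>b. best_upto k s0 u b \<and> folded k u p b s0 s'))"
    proof (rule exec_mono)
      fix t' s' assume B: "t' \<le> 2 + k * 11 \<and>
        unchanged {''i'', ''a'', ''choice'', ''inside'', ''blocked''} {''cost''} s s' \<and>
        folded k u p (words s ''best'' 0) s s'"
      have "unchanged {''u'', ''p'', ''j'', ''best''} {} s0 s"
        by (rule unchanged_trans[OF un1 un2]) auto
      moreover have "unchanged {''i'', ''a'', ''choice'', ''inside'', ''blocked''} {''cost''} s s'"
        using B by simp
      ultimately have "unchanged {''u'', ''p'', ''j'', ''best'', ''i'', ''a'', ''choice'', ''inside'', ''blocked''} {''cost''} s0 s'"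
        by (rule unchanged_trans) auto
      moreover have "folded k u p (words s ''best'' 0) s0 s'"
        using B folded_cong[of s] by (simp add: t1 t2)
      ultimately show "t + t' \<le> 5 + k * 15 \<and>
        unchanged {''u'', ''p'', ''j'', ''best'', ''i'', ''a'', ''choice'', ''inside'', ''blocked''} {''cost''} s0 s' \<and>
        (\<exists>b. best_upto k s0 u b \<and> folded k u p b s0 s')"
        using A B bk by auto
    qed
  qed
  then show ?thesis
    unfolding merge_vertex_def exec_Seq[of W "Write a i e" for a i e] exec_Write
    using h u p by (simp add: s1_def)
qed

text \<open>The recurrence with only the first \<open>h\<close> vertices of the order counted as
  children: \<open>h = 0\<close> describes the initialized tables, \<open>h = n - 1\<close> supplies
  what the optimality proof assumes.\<close>

definition tables :: "(nat \<Rightarrow> nat) \<Rightarrow> (nat \<Rightarrow> nat) \<Rightarrow> nat \<Rightarrow> store \<Rightarrow> bool" where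
  "tables ord par h s \<longleftrightarrow>
    (\<forall>v<n. \<forall>i<k. (ins s v i \<longleftrightarrow> v = c i \<or> (\<exists>j<h. par (ord j) = v \<and> ins s (ord j) i)) \<and>
      (\<forall>r. fits s r v i \<longleftrightarrow> (\<forall>j<k. c j = v \<longrightarrow> j = i) \<and> d v (c i) \<le> r \<and>
        (\<forall>j<h. par (ord j) = v \<longrightarrow> fits s r (ord j) (pick s (ord j) i)))) \<and>
    (\<forall>j<h. \<forall>i<k. pick s (ord j) i < k \<and>
      (pick s (ord j) i = i \<or> \<not> ins s (ord j) i \<and> ins s (ord j) (pick s (ord j) i)) \<and>
      (\<forall>r. fits s r (ord j) i \<longrightarrow> fits s r (ord j) (pick s (ord j) i)) \<and>
      (\<forall>i'<k. \<forall>r. \<not> ins s (ord j) i \<longrightarrow> ins s (ord j) i' \<longrightarrow> fits s r (ord j) i' \<longrightarrow>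
        fits s r (ord j) (pick s (ord j) i)))"

text \<open>Merging \<open>ord h\<close> changes entries only in the row of its parent, which comes
  later in the order. The rows of \<open>ord 0\<close> to \<open>ord h\<close> are therefore final,
  clauses about earlier children carry over, and only the parent's clause gains a child.\<close>

lemma tables_step:
  assumes elim: "elimination_order {..<n} n E ord par" and tab: "tables ord par h s" and h: "h < n - 1"
    and b: "best_upto k s (ord h) b" and fold: "folded k (ord h) (par (ord h)) b s s'"
  shows "tables ord par (Suc h) s'"
proof -
  interpret elimination_order "{..<n}" n E ord par by (rule elim)
  define u p where "u = ord h" and "p = par u"
  obtain l where l: "h < l" "l < n" "p = ord l" using par[OF h] by (auto simp: u_def p_def)
  have ord_less: "ord j < n" if "j \<le> h" for j using that h ord_in[of j] by simp
  have ne: "ord j \<noteq> p" if "j \<le> h" for j using ord_inj[of j l] that l h by auto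
  have ne_u: "ord j \<noteq> u" if "j < h" for j using ord_inj[of j h] that h by (auto simp: u_def)
  have new: "ins s' v i \<longleftrightarrow> ins s v i \<or> v = p \<and> ins s u i"
    "fits s' r v i \<longleftrightarrow> fits s r v i \<and> (v = p \<longrightarrow> fits s r u (chosen s u b i))"
    "pick s' v i = (if v = u then chosen s u b i else pick s v i)" if "v < n" "i < k" for v i r
    using fold that unfolding folded_def u_def[symmetric] p_def[symmetric] by simp_all
  have old: "ins s' (ord j) i = ins s (ord j) i" "fits s' r (ord j) i = fits s r (ord j) i"
    if "j \<le> h" "i < k" for j i r
    using new[OF ord_less[OF that(1)] that(2)] ne[OF that(1)] by simp_all
  have old_pick: "pick s' (ord j) i = pick s (ord j) i" if "j < h" "i < k" for j i
    using new(3)[OF ord_less[of j] that(2)] ne_u[OF that(1)] that by simp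
  have new_pick: "pick s' u i = chosen s u b i" if "i < k" for i
    using new(3)[OF ord_less[of h] that] by (simp add: u_def)
  have b': "best_upto k s u b" using b by (simp add: u_def)
  note ch = chosen_props[OF b']
  have pick_less: "pick s (ord j) i < k" if "j < h" "i < k" for j i
    using tab that unfolding tables_def by blast
  show ?thesis
    unfolding tables_def
  proof (intro conjI)
    show "\<forall>v<n. \<forall>i<k. (ins s' v i \<longleftrightarrow> v = c i \<or> (\<exists>j<Suc h. par (ord j) = v \<and> ins s' (ord j) i)) \<and>
      (\<forall>r. fits s' r v i \<longleftrightarrow> (\<forall>j<k. c j = v \<longrightarrow> j = i) \<and> d v (c i) \<le> r \<and>
        (\<forall>j<Suc h. par (ord j) = v \<longrightarrow> fits s' r (ord j) (pick s' (ord j) i)))"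
    proof (intro allI impI)
      fix v i assume v: "v < n" and i: "i < k"
      have tab_ins: "ins s v i \<longleftrightarrow> v = c i \<or> (\<exists>j<h. par (ord j) = v \<and> ins s (ord j) i)"
        and tab_fits: "\<And>r. fits s r v i \<longleftrightarrow> (\<forall>j<k. c j = v \<longrightarrow> j = i) \<and> d v (c i) \<le> r \<and>
          (\<forall>j<h. par (ord j) = v \<longrightarrow> fits s r (ord j) (pick s (ord j) i))"
        using tab v i unfolding tables_def by blast+
      have "(\<exists>j<Suc h. par (ord j) = v \<and> ins s' (ord j) i) \<longleftrightarrow>
          p = v \<and> ins s u i \<or> (\<exists>j<h. par (ord j) = v \<and> ins s (ord j) i)"
        using old(1)[OF _ i] by (auto simp: less_Suc_eq u_def p_def)
      then have 1: "ins s' v i \<longleftrightarrow> v = c i \<or> (\<exists>j<Suc h. par (ord j) = v \<and> ins s' (ord j) i)"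
        using new(1)[OF v i] tab_ins by blast
      have kids: "(\<forall>j<Suc h. par (ord j) = v \<longrightarrow> fits s' r (ord j) (pick s' (ord j) i)) \<longleftrightarrow>
          (p = v \<longrightarrow> fits s r u (chosen s u b i)) \<and>
          (\<forall>j<h. par (ord j) = v \<longrightarrow> fits s r (ord j) (pick s (ord j) i))" for r
      proof -
        have "fits s' r (ord j) (pick s' (ord j) i) = fits s r (ord j) (pick s (ord j) i)" if "j < h" for j
          using old(2)[of j "pick s (ord j) i"] old_pick[OF that i] pick_less[OF that i] that by simp
        moreover have "fits s' r u (pick s' u i) = fits s r u (chosen s u b i)"
          using old(2)[of h "chosen s u b i"] new_pick[OF i] ch(1)[OF i] by (simp add: u_def)
        ultimately show ?thesis by (auto simp: less_Suc_eq u_def p_def)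
      qed
      show "(ins s' v i \<longleftrightarrow> v = c i \<or> (\<exists>j<Suc h. par (ord j) = v \<and> ins s' (ord j) i)) \<and>
      (\<forall>r. fits s' r v i \<longleftrightarrow> (\<forall>j<k. c j = v \<longrightarrow> j = i) \<and> d v (c i) \<le> r \<and>
        (\<forall>j<Suc h. par (ord j) = v \<longrightarrow> fits s' r (ord j) (pick s' (ord j) i)))"
      proof (intro conjI allI)
        fix r
        show "fits s' r v i \<longleftrightarrow> (\<forall>j<k. c j = v \<longrightarrow> j = i) \<and> d v (c i) \<le> r \<and>
          (\<forall>j<Suc h. par (ord j) = v \<longrightarrow> fits s' r (ord j) (pick s' (ord j) i))"
          unfolding kids new(2)[OF v i] tab_fits by blast
      qed (rule 1)
    qed
    show "\<forall>j<Suc h. \<forall>i<k. pick s' (ord j) i < k \<and>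
      (pick s' (ord j) i = i \<or> \<not> ins s' (ord j) i \<and> ins s' (ord j) (pick s' (ord j) i)) \<and>
      (\<forall>r. fits s' r (ord j) i \<longrightarrow> fits s' r (ord j) (pick s' (ord j) i)) \<and>
      (\<forall>i'<k. \<forall>r. \<not> ins s' (ord j) i \<longrightarrow> ins s' (ord j) i' \<longrightarrow> fits s' r (ord j) i' \<longrightarrow>
        fits s' r (ord j) (pick s' (ord j) i))"
    proof (intro allI impI)
      fix j i assume j: "j < Suc h" and i: "i < k"
      show "pick s' (ord j) i < k \<and>
      (pick s' (ord j) i = i \<or> \<not> ins s' (ord j) i \<and> ins s' (ord j) (pick s' (ord j) i)) \<and>
      (\<forall>r. fits s' r (ord j) i \<longrightarrow> fits s' r (ord j) (pick s' (ord j) i)) \<and>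
      (\<forall>i'<k. \<forall>r. \<not> ins s' (ord j) i \<longrightarrow> ins s' (ord j) i' \<longrightarrow> fits s' r (ord j) i' \<longrightarrow>
        fits s' r (ord j) (pick s' (ord j) i))"
      proof (cases "j = h")
        case True
        have 2: "ins s' u i' = ins s u i'" "fits s' r u i' = fits s r u i'" if "i' < k" for i' r
          using old[of h] that by (simp_all add: u_def)
        have "ord j = u" using True by (simp add: u_def)
        then show ?thesis
          using ch[OF i] i by (simp add: new_pick[OF i] 2)
      next
        case False
        with j have j': "j < h" by simp
        then have 2: "ins s' (ord j) i' = ins s (ord j) i'" "fits s' r (ord j) i' = fits s r (ord j) i'"
          if "i' < k" for i' r
          using old[of j] that by simp_all
        show ?thesis
          using tab j' i pick_less[OF j' i] unfolding tables_def
          by (simp add: old_pick[OF j' i] 2)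
      qed
    qed
  qed
qed

lemma exec_merge:
  assumes s0: "input s0" and elim: "elimination_order {..<n} n E (words s0 ''order'') (words s0 ''parent'')"
    and tab: "tables (words s0 ''order'') (words s0 ''parent'') 0 s0"
  shows "exec W (For ''h'' (Minus (var ''n'') (Const 1)) merge_vertex) s0 (\<lambda>t s. t \<le> 2 + n * (9 + k * 15) \<and>
    unchanged {''h'', ''u'', ''p'', ''j'', ''best'', ''i'', ''a'', ''choice'', ''inside'', ''blocked''} {''cost''} s0 s \<and>
    tables (words s0 ''order'') (words s0 ''parent'') (n - 1) s)"
  (is "exec _ _ _ ?Q")
proof -
  interpret elimination_order "{..<n}" n E "words s0 ''order''" "words s0 ''parent''" by (rule elim)
  define ord pr where "ord = words s0 ''order''" and "pr = words s0 ''parent''"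
  define I where "I h s \<longleftrightarrow>
    unchanged {''h'', ''u'', ''p'', ''j'', ''best'', ''i'', ''a'', ''choice'', ''inside'', ''blocked''} {''cost''} s0 s \<and>
    tables ord pr h s" for h s
  have I_input: "input s" if "I j s" for j s
    using that unfolding I_def by (auto intro: input_unchanged[OF s0])
  have tables_set: "tables ord pr h (set_word ''h'' 0 x s) = tables ord pr h s" for h x s
    by (simp add: tables_def ins_def fits_def pick_def)
  show ?thesis
  proof (rule exec_For[where m = "n - 1" and T = "7 + k * 15" and I = I])
    show "I 0 (set_word ''h'' 0 0 s0)" using tab tables_set[of 0 0 s0, unfolded ord_def pr_def] by (simp add: I_def ord_def pr_def)
    show "eval_expr W s (Minus (var ''n'') (Const 1)) = Some (n - 1)" if "I j s" for j s
      using I_input[OF that] by simp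
    show "?Q t s"
      if t: "t \<le> 2 + (n - 1) * (7 + k * 15 + 2)" and "I (n - 1) s" for t s
    proof -
      have "(n - 1) * (7 + k * 15 + 2) \<le> n * (9 + k * 15)" by (intro mult_mono) auto
      with t have "t \<le> 2 + n * (9 + k * 15)" by linarith
      with that(2) show ?thesis unfolding I_def ord_def pr_def by blast
    qed
    fix h s assume h: "h < n - 1" and hs: "words s ''h'' 0 = h" and I: "I h s"
    have un: "unchanged {''h'', ''u'', ''p'', ''j'', ''best'', ''i'', ''a'', ''choice'', ''inside'', ''blocked''} {''cost''} s0 s"
      using I by (simp add: I_def)
    have arrays: "words s ''order'' = ord" "words s ''parent'' = pr"
      using unchanged_words[OF un] by (simp_all add: ord_def pr_def)
    have u: "ord h < n" using ord_in[of h] h by (simp add: ord_def)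
    obtain l where l: "h < l" "l < n" "pr (ord h) = ord l"
      using par[OF h] by (auto simp: ord_def pr_def)
    then have p: "pr (ord h) < n" "ord h \<noteq> pr (ord h)"
      using ord_in[of l] ord_inj[of h l] by (auto simp: ord_def)
    have h_le: "h \<le> n" using h by simp
    let ?Post = "\<lambda>(t :: nat) s'. t \<le> 7 + k * 15 \<and>
      unchanged {''u'', ''p'', ''j'', ''best'', ''i'', ''a'', ''choice'', ''inside'', ''blocked''} {''cost''} s s' \<and>
      (\<exists>b. best_upto k s (ord h) b \<and> folded k (ord h) (pr (ord h)) b s s')"
    have "exec W merge_vertex s ?Post"
      by (rule exec_merge_vertex[OF I_input[OF I] hs h_le _ u _ p]) (simp_all add: arrays)
    then show "exec W merge_vertex s
      (\<lambda>t s'. t \<le> 7 + k * 15 \<and> words s' ''h'' 0 = h \<and> I (Suc h) (set_word ''h'' 0 (Suc h) s'))"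
    proof (rule exec_mono, intro conjI)
      fix t s' assume A: "?Post t s'"
      then have un': "unchanged {''u'', ''p'', ''j'', ''best'', ''i'', ''a'', ''choice'', ''inside'', ''blocked''} {''cost''} s s'"
        by simp
      show "t \<le> 7 + k * 15" using A by simp
      show "words s' ''h'' 0 = h" using hs unchanged_words[OF un', of "''h''"] by simp
      have "tables ord pr (Suc h) s'"
        using A I tables_step[OF elim _ h] unfolding I_def ord_def pr_def by blast
      moreover have "unchanged {''h'', ''u'', ''p'', ''j'', ''best'', ''i'', ''a'', ''choice'', ''inside'', ''blocked''} {''cost''} s0 s'"
        by (rule unchanged_trans[OF un un']) auto
      ultimately show "I (Suc h) (set_word ''h'' 0 (Suc h) s')" by (simp add: I_def tables_set)
    qed
  qed simp_all
qed

lemma tables_assignment: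
  assumes elim: "elimination_order {..<n} n E ord par" and tab: "tables ord par (n - 1) s"
    and b: "best_upto k s (ord (n - 1)) b"
  shows "assignment_tables {..<n} n E ord par d k c (ins s) (fits s) (pick s) b"
proof -
  interpret elimination_order "{..<n}" n E ord par by (rule elim)
  show ?thesis
  proof (unfold_locales, goal_cases)
    case 1
    show ?case by (rule inst)
  next
    case (2 v i)
    then show ?case using tab unfolding tables_def by blast
  next
    case (3 v i r)
    then show ?case using tab unfolding tables_def by blast
  next
    case (4 j i)
    then show ?case using tab unfolding tables_def by blast
  next
    case (5 j i)
    then show ?case using tab unfolding tables_def by blast
  next
    case (6 j i r)
    then show ?case using tab unfolding tables_def by blast
  next
    case (7 j i i' r)
    then show ?case using tab unfolding tables_def by blast
  next
    case (8 i r)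
    then show ?case using b unfolding best_upto_def by blast
  qed
qed

text \<open>The loop invariant covers the positions from \<open>n - 1 - m\<close> on and refers to
  the tables of the starting store, which this phase does not write. It includes that assigned
  indices are below \<open>k\<close>, because they serve as columns of \<open>choice\<close> once
  the children are reached.\<close>

lemma exec_assign:
  assumes s0: "input s0" and elim: "elimination_order {..<n} n E (words s0 ''order'') (words s0 ''parent'')"
    and tab: "tables (words s0 ''order'') (words s0 ''parent'') (n - 1) s0"
  shows "exec W (Seq assign_root (For ''h'' (Minus (var ''n'') (Const 1)) assign_vertex)) s0
    (\<lambda>t s. t \<le> 7 + k * 4 + n * 4 \<and> optimal_clusters {..<n} E d k c (output_clusters n s))"
proof -
  define ord par where "ord = words s0 ''order''" and "par = words s0 ''parent''"
  note defs = ord_def[symmetric] par_def[symmetric]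
  interpret elimination_order "{..<n}" n E ord par using elim by (simp add: defs)
  define root where "root = ord (n - 1)"
  have root: "root < n" using ord_in[of "n - 1"] n_pos by (simp add: root_def)
  define s1 where "s1 = set_word ''u'' 0 root s0"
  have un1: "unchanged {''u''} {} s0 s1" by (simp add: s1_def)
  have s1: "input s1" by (rule input_unchanged[OF s0 un1]) simp_all
  note t1 = unchanged_tables[OF un1, simplified]
  have "exec W scan s1 (\<lambda>t s. t \<le> 3 + k * 4 \<and> unchanged {''j'', ''best''} {} s1 s \<and>
      best_upto k s1 root (words s ''best'' 0))"
    by (rule exec_scan[OF s1]) (simp_all add: s1_def root)
  then have root_step: "exec W assign_root s0 (\<lambda>t s. t \<le> 5 + k * 4 \<and>
    unchanged {''u'', ''j'', ''best'', ''cluster''} {} s0 s \<and>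
    best_upto k s0 root (words s ''cluster'' root))"
  proof -
    assume A: "exec W scan s1 (\<lambda>t s. t \<le> 3 + k * 4 \<and> unchanged {''j'', ''best''} {} s1 s \<and>
      best_upto k s1 root (words s ''best'' 0))"
    have "exec W (Seq scan (Write ''cluster'' (var ''u'') (var ''best''))) s1 (\<lambda>t s. t \<le> 4 + k * 4 \<and>
      unchanged {''u'', ''j'', ''best'', ''cluster''} {} s0 s \<and>
      best_upto k s0 root (words s ''cluster'' root))"
      unfolding exec_Seq
    proof (rule exec_mono[OF A])
      fix t s assume B: "t \<le> 3 + k * 4 \<and> unchanged {''j'', ''best''} {} s1 s \<and>
        best_upto k s1 root (words s ''best'' 0)"
      then have un2: "unchanged {''j'', ''best''} {} s1 s" by simp
      have us: "words s ''u'' 0 = root" using unchanged_words[OF un2] by (simp add: s1_def)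
      have "words s ''best'' 0 \<le> n" using B k_le by (simp add: best_upto_def)
      moreover have "unchanged {''u'', ''j'', ''best'', ''cluster''} {} s0 s"
        by (rule unchanged_trans[OF un1 un2]) auto
      ultimately show "exec W (Write ''cluster'' (var ''u'') (var ''best'')) s (\<lambda>t' s. t + t' \<le> 4 + k * 4 \<and>
        unchanged {''u'', ''j'', ''best'', ''cluster''} {} s0 s \<and>
        best_upto k s0 root (words s ''cluster'' root))"
        using B us root by (simp add: exec_simps t1)
    qed
    then show ?thesis
      unfolding assign_root_def exec_Seq[of W "Write a i e" for a i e] exec_Write
      using s0 n_pos by (simp add: s1_def root_def ord_def)
  qed
  show ?thesis
    unfolding exec_Seq
  proof (rule exec_mono[OF root_step])
    fix t1 s2 assume A: "t1 \<le> 5 + k * 4 \<and> unchanged {''u'', ''j'', ''best'', ''cluster''} {} s0 s2 \<and>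
      best_upto k s0 root (words s2 ''cluster'' root)"
    then have un2: "unchanged {''u'', ''j'', ''best'', ''cluster''} {} s0 s2" by simp
    define b where "b = words s2 ''cluster'' root"
    have b: "best_upto k s0 root b" using A by (simp add: b_def)
    interpret assignment_tables "{..<n}" n E ord par d k c "ins s0" "fits s0" "pick s0" b
      using tables_assignment elim tab b by (simp add: defs root_def)
    define I where "I m s \<longleftrightarrow> unchanged {''u'', ''j'', ''best'', ''cluster'', ''h''} {} s0 s \<and>
      words s ''cluster'' root = b \<and>
      (\<forall>i<n. n - 1 - m \<le> i \<longrightarrow> words s ''cluster'' (ord i) < k) \<and>
      (\<forall>i<n - 1. n - 1 - m \<le> i \<longrightarrow>
        words s ''cluster'' (ord i) = pick s0 (ord i) (words s ''cluster'' (par (ord i))))" for m s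
    have I_input: "input s" if "I j s" for j s
      using that unfolding I_def by (auto intro: input_unchanged[OF s0])
    show "exec W (For ''h'' (Minus (var ''n'') (Const 1)) assign_vertex) s2 (\<lambda>t s. t1 + t \<le> 7 + k * 4 + n * 4 \<and>
      optimal_clusters {..<n} E d k c (output_clusters n s))"
    proof (rule exec_For[where m = "n - 1" and T = 2 and I = I])
      have "unchanged {''u'', ''j'', ''best'', ''cluster'', ''h''} {} s0 s2"
        by (rule unchanged_trans[OF un2 unchanged_refl[of "{}" "{}"]]) auto
      moreover have "words s2 ''cluster'' (ord i) < k" if "i < n" "n - 1 \<le> i" for i
      proof -
        have "i = n - 1" using that by simp
        then show ?thesis using best_less by (simp only: root_def[symmetric] b_def[symmetric])
      qed
      ultimately show "I 0 (set_word ''h'' 0 0 s2)" by (simp add: I_def b_def)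
      show "eval_expr W s (Minus (var ''n'') (Const 1)) = Some (n - 1)" if "I j s" for j s
        using I_input[OF that] by simp
      show "t1 + t \<le> 7 + k * 4 + n * 4 \<and> optimal_clusters {..<n} E d k c (output_clusters n s)"
        if t: "t \<le> 2 + (n - 1) * (2 + 2)" and I: "I (n - 1) s" for t s
      proof
        have "(n - 1) * (2 + 2) \<le> n * 4" by simp
        with t A show "t1 + t \<le> 7 + k * 4 + n * 4" by linarith
        have "optimal_clusters {..<n} E d k c (\<lambda>i. {v \<in> {..<n}. words s ''cluster'' v = i})"
        proof (rule tables_optimal)
          show "words s ''cluster'' (ord (n - 1)) = b" using I by (simp add: I_def root_def)
          show "words s ''cluster'' (ord j) = pick s0 (ord j) (words s ''cluster'' (par (ord j)))"
            if "j < n - 1" for j using I that by (simp add: I_def)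
          \<comment> \<open>The number stored in the root's cost cell is itself the
            threshold.\<close>
          show "\<exists>m. \<forall>r. fits s0 r (ord (n - 1)) b \<longleftrightarrow> fits s0 m (ord (n - 1)) b \<and> m \<le> r"
            by (intro exI[of _ "reals s0 ''cost'' (idx (ord (n - 1)) b)"]) (simp add: fits_def)
        qed
        then show "optimal_clusters {..<n} E d k c (output_clusters n s)"
          by (simp add: output_clusters_def[abs_def])
      qed
      fix m s assume m: "m < n - 1" and ms: "words s ''h'' 0 = m" and I: "I m s"
      note [simp] = I_input[OF I]
      have un: "unchanged {''u'', ''j'', ''best'', ''cluster'', ''h''} {} s0 s" using I by (simp add: I_def)
      have arrays: "words s ''order'' = ord" "words s ''parent'' = par" "words s ''choice'' = words s0 ''choice''"
        using unchanged_words[OF un] by (simp_all add: ord_def par_def)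
      define l where "l = n - 2 - m"
      have l: "l < n - 1" "l = n - 1 - Suc m" "n - 1 - m = Suc l" using m by (auto simp: l_def)
      define u where "u = ord l"
      have u: "u < n" using ord_in[of l] l by (simp add: u_def)
      obtain l' where l': "l < l'" "l' < n" "par u = ord l'"
        using par[OF l(1)] by (auto simp: u_def)
      have pu: "par u < n" using l' ord_in[of l'] by simp
      have other: "ord i \<noteq> u" if "l < i" "i < n" for i
        using ord_inj[of i l] that l by (auto simp: u_def)
      define x where "x = words s ''cluster'' (par u)"
      have x: "x < k" using I l l' unfolding I_def x_def by simp
      define y where "y = pick s0 u x"
      have y: "y < k" using choice_less[OF l(1) x] by (simp add: y_def u_def)
      let ?Post = "\<lambda>(t :: nat) s'. t \<le> 2 \<and> words s' ''h'' 0 = m \<and>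
        unchanged {''u'', ''j'', ''best'', ''cluster'', ''h''} {} s0 s' \<and>
        words s' ''cluster'' = (words s ''cluster'')(u := y)"
      have "exec W assign_vertex s ?Post"
      proof -
        have le: "m \<le> n" "l \<le> n" "x \<le> k" "u \<le> n" using m l x u by simp_all
        have "n - Suc (Suc m) = l" by (simp add: l_def)
        then show ?thesis
          using un ms le u pu y unfolding assign_vertex_def
          by (simp add: exec_simps arrays u_def[symmetric] x_def[symmetric]
              y_def[unfolded pick_def, symmetric])
      qed
      then show "exec W assign_vertex s
        (\<lambda>t s'. t \<le> 2 \<and> words s' ''h'' 0 = m \<and> I (Suc m) (set_word ''h'' 0 (Suc m) s'))"
      proof (rule exec_mono, intro conjI)
        fix t s' assume B: "?Post t s'"
        show "t \<le> 2" "words s' ''h'' 0 = m" using B by simp_all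
        have cl: "words s' ''cluster'' (ord i) = (if i = l then y else words s ''cluster'' (ord i))"
          if "l \<le> i" "i < n" for i
          using B other[of i] that by (auto simp: u_def)
        have "words s' ''cluster'' root = b"
          using cl[of "n - 1"] l I unfolding I_def root_def by simp
        moreover have "words s' ''cluster'' (ord i) < k" if "i < n" "l \<le> i" for i
          using cl[OF that(2,1)] y I that unfolding I_def l(3) by simp
        moreover have "words s' ''cluster'' (ord i) = pick s0 (ord i) (words s' ''cluster'' (par (ord i)))"
          if i: "i < n - 1" "l \<le> i" for i
        proof -
          obtain i' where i': "i < i'" "i' < n" "par (ord i) = ord i'" using par[OF i(1)] by blast
          then have same: "words s' ''cluster'' (par (ord i)) = words s ''cluster'' (par (ord i))"
            using cl[of i'] i by simp
          show ?thesis
          proof (cases "i = l")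
            case True
            then show ?thesis using same cl[of i] i by (simp add: y_def x_def u_def)
          next
            case False
            then show ?thesis using same cl[of i] i I unfolding I_def l(3) by simp
          qed
        qed
        ultimately show "I (Suc m) (set_word ''h'' 0 (Suc m) s')"
          using B unfolding I_def l(2)[symmetric] by simp
      qed
    qed simp_all
  qed
qed

end

section \<open>The complete algorithm\<close>

definition connected_assignment :: program where
  "connected_assignment =
    Seq (For ''e'' (var ''edges'') count_edge)
    (Seq (For ''v'' (var ''n'') collect_leaf)
    (Seq (For ''h'' (Minus (var ''n'') (Const 1)) peel_leaf)
    (Seq (For ''i'' (var ''k'') mark_center)
    (Seq (For ''q'' (Times (var ''n'') (var ''k'')) init_cell)
    (Seq (For ''h'' (Minus (var ''n'') (Const 1)) merge_vertex)
    (Seq assign_root (For ''h'' (Minus (var ''n'') (Const 1)) assign_vertex)))))))"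

context tree_instance
begin

lemma input_input_store: "input (input_store n es d k c)"
  using index_less[of _ _ n] by (auto simp: input_def input_store_def)

lemma exec_connected_assignment:
  "exec W connected_assignment (input_store n es d k c)
    (\<lambda>t s. t \<le> 100 * (n * k) \<and> optimal_clusters {..<n} E d k c (output_clusters n s))"
proof -
  define s0 where "s0 = input_store n es d k c"
  have s0: "input s0" using input_input_store by (simp add: s0_def)
  have zero: "words s0 ''deg'' v = 0" "words s0 ''sum'' v = 0" "words s0 ''tail'' v = 0" "words s0 ''owner'' v = 0" for v
    by (simp_all add: s0_def input_store_def)
  let ?Q = "\<lambda>t s. t \<le> 100 * (n * k) \<and> optimal_clusters {..<n} E d k c (output_clusters n s)"
  let ?P7 = "\<lambda>t s. exec W (Seq assign_root (For ''h'' (Minus (var ''n'') (Const 1)) assign_vertex)) s (\<lambda>t'. ?Q (t + t'))"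
  let ?P6 = "\<lambda>t s. exec W (For ''h'' (Minus (var ''n'') (Const 1)) merge_vertex) s (\<lambda>t'. ?P7 (t + t'))"
  let ?P5 = "\<lambda>t s. exec W (For ''q'' (Times (var ''n'') (var ''k'')) init_cell) s (\<lambda>t'. ?P6 (t + t'))"
  let ?P4 = "\<lambda>t s. exec W (For ''i'' (var ''k'') mark_center) s (\<lambda>t'. ?P5 (t + t'))"
  let ?P3 = "\<lambda>t s. exec W (For ''h'' (Minus (var ''n'') (Const 1)) peel_leaf) s (\<lambda>t'. ?P4 (t + t'))"
  let ?P2 = "\<lambda>t s. exec W (For ''v'' (var ''n'') collect_leaf) s (\<lambda>t'. ?P3 (t + t'))"
  show ?thesis
    unfolding connected_assignment_def s0_def[symmetric] exec_Seq[of W "For x N P" for x N P] add.assoc[symmetric]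
  proof (rule exec_mono[OF exec_count_edges[OF s0 zero(1,2)]])
    fix t1 s1 assume 1: "t1 \<le> 2 + length es * 8 \<and>
      unchanged {''e'', ''x'', ''y'', ''deg'', ''sum''} {} s0 s1 \<and>
      (\<forall>v. words s1 ''deg'' v = card (adj {..<n} v) \<and> words s1 ''sum'' v = \<Sum>(adj {..<n} v))"
    then have un1: "unchanged {''e'', ''x'', ''y'', ''deg'', ''sum''} {} s0 s1" by simp
    have s1: "input s1" by (rule input_unchanged[OF s0 un1]) simp_all
    have tail1: "words s1 ''tail'' 0 = 0" using unchanged_words[OF un1] zero by simp
    show "?P2 t1 s1"
    proof (rule exec_mono[OF exec_collect_leaves[OF s1 tail1]])
      fix t2 s2 assume 2: "t2 \<le> 2 + n * 5 \<and>
        unchanged {''v'', ''order'', ''tail''} {} s1 s2 \<and> inj_on (words s2 ''order'') {..<words s2 ''tail'' 0} \<and>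
        words s2 ''order'' ` {..<words s2 ''tail'' 0} = {v \<in> {..<n}. words s2 ''deg'' v < 2}"
      then have un2: "unchanged {''v'', ''order'', ''tail''} {} s1 s2" by blast
      have s2: "input s2" by (rule input_unchanged[OF s1 un2]) simp_all
      have counts: "words s2 ''deg'' v = card (adj {..<n} v)" "words s2 ''sum'' v = \<Sum>(adj {..<n} v)" for v
      proof -
        have same: "words s2 ''deg'' = words s1 ''deg''" "words s2 ''sum'' = words s1 ''sum''"
          using unchanged_words[OF un2] by simp_all
        show "words s2 ''deg'' v = card (adj {..<n} v)" "words s2 ''sum'' v = \<Sum>(adj {..<n} v)"
          unfolding same using 1 by blast+
      qed
      have q2: "inj_on (words s2 ''order'') {..<words s2 ''tail'' 0}"
        "words s2 ''order'' ` {..<words s2 ''tail'' 0} = {v \<in> {..<n}. words s2 ''deg'' v < 2}"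
        using 2 by blast+
      show "?P3 (t1 + t2) s2"
      proof (rule exec_mono[OF exec_peel_leaves[OF s2 counts q2]])
        fix t3 s3 assume 3: "t3 \<le> 2 + n * 10 \<and>
          unchanged {''h'', ''u'', ''p'', ''parent'', ''deg'', ''sum'', ''order'', ''tail''} {} s2 s3 \<and>
          elimination_order {..<n} n E (words s3 ''order'') (words s3 ''parent'')"
        then have un3: "unchanged {''h'', ''u'', ''p'', ''parent'', ''deg'', ''sum'', ''order'', ''tail''} {} s2 s3"
          and elim3: "elimination_order {..<n} n E (words s3 ''order'') (words s3 ''parent'')" by simp_all
        have s3: "input s3" by (rule input_unchanged[OF s2 un3]) simp_all
        have zero3: "words s3 ''owner'' v = 0" for v
          using unchanged_words[OF un1] unchanged_words[OF un2] unchanged_words[OF un3] zero by simp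
        \<comment> \<open>The parent edges exhaust \<open>E\<close>, so the loop over the edge list
          is linear in \<open>n\<close>.\<close>
        have "card E \<le> n - 1"
          unfolding elimination_order.edges[OF elim3]
          using card_image_le[of "{..<n - 1}" "\<lambda>i. {words s3 ''order'' i, words s3 ''parent'' (words s3 ''order'' i)}"]
          by simp
        then have edges: "length es \<le> n" by (simp add: length_es)
        show "?P4 (t1 + t2 + t3) s3"
        proof (rule exec_mono[OF exec_mark_centers[OF s3 zero3]])
          fix t4 s4 assume 4: "t4 \<le> 2 + k * 3 \<and>
            unchanged {''i'', ''owner''} {} s3 s4 \<and> (\<forall>i<k. words s4 ''owner'' (c i) = Suc i) \<and>
            (\<forall>v. v \<notin> c ` {..<k} \<longrightarrow> words s4 ''owner'' v = 0)"
          then have un4: "unchanged {''i'', ''owner''} {} s3 s4" by simp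
          have s4: "input s4" by (rule input_unchanged[OF s3 un4]) simp_all
          have own4: "\<And>i. i < k \<Longrightarrow> words s4 ''owner'' (c i) = Suc i"
            "\<And>v. v \<notin> c ` {..<k} \<Longrightarrow> words s4 ''owner'' v = 0" using 4 by blast+
          show "?P5 (t1 + t2 + t3 + t4) s4"
          proof (rule exec_mono[OF exec_init_tables[OF s4 own4]])
            fix t5 s5 assume 5: "t5 \<le> 2 + n * k * 7 \<and>
              unchanged {''q'', ''v'', ''i'', ''inside'', ''blocked''} {''cost''} s4 s5 \<and>
              (\<forall>v<n. \<forall>i<k. (ins s5 v i \<longleftrightarrow> v = c i) \<and>
                (\<forall>r. fits s5 r v i \<longleftrightarrow> (\<forall>j<k. c j = v \<longrightarrow> j = i) \<and> d v (c i) \<le> r))"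
            then have un5: "unchanged {''q'', ''v'', ''i'', ''inside'', ''blocked''} {''cost''} s4 s5" by simp
            have s5: "input s5" by (rule input_unchanged[OF s4 un5]) simp_all
            have arrays5: "words s5 ''order'' = words s3 ''order''" "words s5 ''parent'' = words s3 ''parent''"
              using unchanged_words[OF un4] unchanged_words[OF un5] by simp_all
            have tab5: "tables (words s5 ''order'') (words s5 ''parent'') 0 s5"
              using 5 by (simp add: tables_def)
            have elim5: "elimination_order {..<n} n E (words s5 ''order'') (words s5 ''parent'')"
              using elim3 by (simp add: arrays5)
            show "?P6 (t1 + t2 + t3 + t4 + t5) s5"
            proof (rule exec_mono[OF exec_merge[OF s5 elim5 tab5]])
              fix t6 s6 assume 6: "t6 \<le> 2 + n * (9 + k * 15) \<and>
                unchanged {''h'', ''u'', ''p'', ''j'', ''best'', ''i'', ''a'', ''choice'', ''inside'', ''blocked''} {''cost''} s5 s6 \<and>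
                tables (words s5 ''order'') (words s5 ''parent'') (n - 1) s6"
              then have un6: "unchanged {''h'', ''u'', ''p'', ''j'', ''best'', ''i'', ''a'', ''choice'', ''inside'', ''blocked''} {''cost''} s5 s6"
                by simp
              have s6: "input s6" by (rule input_unchanged[OF s5 un6]) simp_all
              have arrays6: "words s6 ''order'' = words s5 ''order''" "words s6 ''parent'' = words s5 ''parent''"
                using unchanged_words[OF un6] by simp_all
              have elim6: "elimination_order {..<n} n E (words s6 ''order'') (words s6 ''parent'')"
                and tab6: "tables (words s6 ''order'') (words s6 ''parent'') (n - 1) s6"
                using elim5 6 by (simp_all add: arrays6)
              show "?P7 (t1 + t2 + t3 + t4 + t5 + t6) s6"
              proof (rule exec_mono[OF exec_assign[OF s6 elim6 tab6]])
                fix t7 s7 assume 7: "t7 \<le> 7 + k * 4 + n * 4 \<and>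
                  optimal_clusters {..<n} E d k c (output_clusters n s7)"
                \<comment> \<open>Bounding \<open>n\<close>, \<open>k\<close> and 1 by
                  \<open>n * k\<close>, the phases cost at most 19 + 36 + 7 + 22 = 84 times
                  \<open>n * k\<close>: the constants, the multiples of \<open>n\<close>, of
                  \<open>k\<close> and of \<open>n * k\<close>. The factor 100 is a round
                  bound.\<close>
                have "n \<le> n * k" "k \<le> n * k" "1 \<le> n * k"
                  using k_pos n_pos by simp_all
                moreover have "n * (9 + k * 15) = 9 * n + 15 * (n * k)" by (simp add: algebra_simps)
                ultimately have "t1 + t2 + t3 + t4 + t5 + t6 + t7 \<le> 100 * (n * k)"
                  using 1 2 3 4 5 6 7 edges by linarith
                with 7 show "?Q (t1 + t2 + t3 + t4 + t5 + t6 + t7) s7" by simp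
              qed
            qed
          qed
        qed
      qed
    qed
  qed
qed

end

theorem theorem41:
  shows "\<exists>(P :: program) (w :: nat) (K :: real).
    \<forall>(n :: nat) (E :: nat set set) (es :: (nat \<times> nat) list) (d :: nat \<Rightarrow> nat \<Rightarrow> real)
     (k :: nat) (c :: nat \<Rightarrow> nat).
      assignment_instance {..<n} E d k c \<longrightarrow> is_tree {..<n} E \<longrightarrow> lists_edges es E \<longrightarrow>
      (\<exists>t s. runs ((n + 1) ^ w) P (input_store n es d k c) t s \<and>
             optimal_clusters {..<n} E d k c (output_clusters n s) \<and>
             (n \<ge> 2 \<longrightarrow> real t \<le> K * (real n * real k * log 2 (real n))))"
proof (rule exI[of _ connected_assignment], rule exI[of _ 3], rule exI[of _ 100], intro allI impI)
  fix n k :: nat and E es and d :: "nat \<Rightarrow> nat \<Rightarrow> real" and c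
  assume "assignment_instance {..<n} E d k c" "is_tree {..<n} E" "lists_edges es E"
  then interpret tree_instance n E es d k c "(n + 1) ^ 3" by unfold_locales auto
  obtain t s where t: "runs ((n + 1) ^ 3) connected_assignment (input_store n es d k c) t s"
      "t \<le> 100 * (n * k)" "optimal_clusters {..<n} E d k c (output_clusters n s)"
    using exec_connected_assignment unfolding exec_def by blast
  have "real t \<le> 100 * (real n * real k * log 2 (real n))" if "n \<ge> 2"
  proof -
    have "real t \<le> real (100 * (n * k))" using t(2) by (simp only: of_nat_le_iff)
    also have "\<dots> = 100 * (real n * real k * 1)" by simp
    \<comment> \<open>For \<open>n \<ge> 2\<close> the logarithm is at least 1, so a bound linear in
      \<open>n * k\<close> is within the claimed one.\<close>
    also have "\<dots> \<le> 100 * (real n * real k * log 2 (real n))"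
      using that by (intro mult_left_mono) (simp_all add: le_log_iff)
    finally show ?thesis .
  qed
  with t show "\<exists>t s. runs ((n + 1) ^ 3) connected_assignment (input_store n es d k c) t s \<and>
    optimal_clusters {..<n} E d k c (output_clusters n s) \<and>
    (2 \<le> n \<longrightarrow> real t \<le> 100 * (real n * real k * log 2 (real n)))" by blast
qed

end
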